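(* Assume the following. (i) The errors $\epsilon_1,\dots,\epsilon_n$ are independent with $\epsilon_i\sim\mathcal N(0,\sigma^2)$, $\sigma>0$. (ii) There is a constant $M<\infty$ with $\|x_i\|_{L_2(\Omega)}\le M$ for all $i=1,\dots,n$. (iii) The vector $\gamma^*=A\eta^*\in\mathbb R^L$ has at most $S$ nonzero components, where $S\ge 1$ is an integer with $3S\le L$. (iv) The matrix $V=XA^+$ satisfies $\phi_{2S}-\theta_{S,2S}>0$. Let $$\lambda=C\sigma\sqrt{\frac{\log p}{n}}+M\mathcal E_b$$ for some constant $C>\sqrt2$, and let $\hat\eta$ be a solution of $$\min_{\eta\in\mathbb R^p}\|A\eta\|_{\ell_1}\quad\text{subject to}\quad\Big\|\frac1n N^{-1}X^\top(y-X\eta)\Big\|_{\ell_\infty}\le\lambda .$$ Put $\hat\beta(t,s)=b^\top(t,s)\hat\eta$, $\mu_i=\iint_\Omega x_i\beta\,dt\,ds$, $\hat\mu_i=\iint_\Omega x_i\hat\beta\,dt\,ds$, $\mu=(\mu_1,\dots,\mu_n)^\top$ and $\hat\mu=(\hat\mu_1,\dots,\hat\mu_n)^\top$. Then, with probability at least $1-p^{1-C^2/2}$, $$\|\hat\beta-\beta\|_{L_2(\Omega)}\le\frac{4C_b\sqrt L\,N_{\max}}{(\phi_{2S}-\theta_{S,2S})\,\sigma_{\min}^2(A)}\,\lambda\sqrt S+\mathcal E_b$$ and $$\|\hat\mu-\mu\|_n\le\frac{4\sqrt L\,N_{\max}}{\sqrt{\phi_{2S}-\theta_{S,2S}}\;\sigma_{\min}(A)}\,\lambda\sqrt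 S+M\mathcal E_b ,$$ where $C_b=\big(\sum_{j=1}^p\iint_\Omega b_j^2(t,s)\,dt\,ds\big)^{1/2}$, $N_{\max}=\max_{1\le j\le p}N_j$, and $\sigma_{\min}(A)$ is the smallest singular value of $A$.
   Context: Setting. $\Omega=[0,1]\times[0,1]$; $\|f\|_{L_2(\Omega)}=(\iint_\Omega f^2\,dt\,ds)^{1/2}$. The (centered) scalar-on-image linear model is $$y_i=\iint_\Omega x_i(t,s)\beta(t,s)\,dt\,ds+\epsilon_i,\qquad i=1,\dots,n,$$ with fixed $x_i\in L_2(\Omega)$, unknown coefficient function $\beta\in L_2(\Omega)$, and random errors $\epsilon_i$; $y=(y_1,\dots,y_n)^\top$. Standing assumptions on $\beta$: it vanishes on some subset of $\Omega$ of positive measure, and for some $r_1,r_2\in\mathbb N$ all partial derivatives $\partial_t^{\alpha_1}\partial_s^{\alpha_2}\beta$ with $0\le\alpha_1\le r_1$, $0\le\alpha_2\le r_2$ lie in $L_2(\Omega)$. Basis. $b_1,\dots,b_p\in L_2(\Omega)$ are given (linearly independent) basis functions, $b=(b_1,\dots,b_p)^\top$. $\eta^*\in\mathbb R^p$ is the minimizer of $\|\beta-b^\top\eta\|_{L_2(\Omega)}$ over $\eta\in\mathbb R^p$, $\beta^*=b^\top\eta^*$, and $\mathcal E_b=\|\beta-\beta^*\|_{L_2(\Omega)}$. $X\in\mathbb R^{n\times p}$ has entries $X_{ij}=\iint_\Omega x_i b_j\,dt\,ds$. For $u\in\mathbb R^n$, $\|u\|_n^2=\frac1n\sum_{i=1}^n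 u_i^2$. $N=\mathrm{diag}(N_1,\dots,N_p)$ with $N_j=\|X_{\cdot j}\|_n$ ($X_{\cdot j}$ the $j$th column of $X$), all $N_j>0$. Matrix $A$. $\{(t_k,s_l):1\le k\le m_1,1\le l\le m_2\}\subset\Omega$ is an evenly spaced grid with grid lengths $\delta_1,\delta_2>0$ in the $t$ and $s$ directions. $\Phi^\top\in\mathbb R^{m_1m_2\times p}$ is the matrix whose row with index $(k-1)m_2+l$ is $(b_1(t_k,s_l),\dots,b_p(t_k,s_l))$. For integers $0\le d<m$, $D_m^d$ is the $(m-d)\times m$ matrix with entries $D_m^d(i,i+k)=(-1)^k\binom dk$ for $k=0,\dots,d$ and $0$ otherwise ($D_m^0=I_m$). For orders $d_1<m_1$, $d_2<m_2$, $A^{d_1,0}=\delta_1^{-d_1}D_{m_1}^{d_1}\otimes I_{m_2}$, $A^{0,d_2}=\delta_2^{-d_2}I_{m_1}\otimes D_{m_2}^{d_2}$, and, for a weight $w>0$, $$A=\begin{bmatrix} wI_{m_1m_2} \\ A^{d_1,0} \\ A^{0,d_2} \end{bmatrix}\Phi^\top\in\mathbb R^{L\times p},\quad L=m_1m_2+(m_1-d_1)m_2+m_1(m_2-d_2).$$ $A$ is assumed to have full column rank ($L\ge p$); $A^+\in\mathbb R^{p\times L}$ is its Moore–Penrose pseudoinverse (so $A^+A=I_p$), and $V=XA^+\in\mathbb R^{n\times L}$. Restricted constants. For $\mathcal T\subseteq\{1,\dots,L\}$, $V_{\mathcal T}$ is the submatrix of $V$ of columns indexed by $\mathcal T$. For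 $1\le S\le L$, $\phi_S$ is the largest constant such that $\phi_S\|c\|_{\ell_2}^2\le\|V_{\mathcal T}c\|_{\ell_2}^2/n$ for all $\mathcal T$ with $|\mathcal T|\le S$ and all $c\in\mathbb R^{|\mathcal T|}$. For $S+S'\le L$, $\theta_{S,S'}\ge0$ is the smallest constant such that $|\langle V_{\mathcal T}c,V_{\mathcal T'}c'\rangle|/n\le\theta_{S,S'}\|c\|_{\ell_2}\|c'\|_{\ell_2}$ for all disjoint $\mathcal T,\mathcal T'$ with $|\mathcal T|\le S$, $|\mathcal T'|\le S'$ and all $c\in\mathbb R^{|\mathcal T|},c'\in\mathbb R^{|\mathcal T'|}$. *)

theory Defs
  imports
    "HOL-Probability.Probability"
    "Jordan_Normal_Form.DL_Rank"
    "Jordan_Normal_Form.DL_Submatrix"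
    "Jordan_Normal_Form.Spectral_Radius"
begin

unbundle no vec_syntax

definition unit_square :: "(real \<times> real) set" where
  "unit_square = {0..1} \<times> {0..1}"

text \<open>Actual functions rather than classes modulo null sets, since basis functions are also evaluated
  at single points.\<close>

definition L2 :: "(real \<times> real \<Rightarrow> real) set" where
  "L2 = {f \<in> borel_measurable (lebesgue_on unit_square).
           integrable (lebesgue_on unit_square) (\<lambda>z. (f z)\<^sup>2)}"

definition inner_L2 :: "(real \<times> real \<Rightarrow> real) \<Rightarrow> (real \<times> real \<Rightarrow> real) \<Rightarrow> real" where
  "inner_L2 f g = (\<integral>z. f z * g z \<partial>(lebesgue_on unit_square))"

definition norm_L2 :: "(real \<times> real \<Rightarrow> real) \<Rightarrow> real" where
  "norm_L2 f = sqrt (\<integral>z. (f z)\<^sup>2 \<partial>(lebesgue_on unit_square))"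

definition partial_t :: "(real \<times> real \<Rightarrow> real) \<Rightarrow> real \<times> real \<Rightarrow> real" where
  "partial_t f = (\<lambda>(t, s). deriv (\<lambda>u. f (u, s)) t)"

definition partial_s :: "(real \<times> real \<Rightarrow> real) \<Rightarrow> real \<times> real \<Rightarrow> real" where
  "partial_s f = (\<lambda>(t, s). deriv (\<lambda>u. f (t, u)) s)"

text \<open>Smooth functions with compact support in the open unit square. Total differentiability of
  all partial derivatives in the one order (first in \<open>s\<close>, then in \<open>t\<close>) suffices for smoothness:
  by Schwarz' theorem the derivatives in any other order then exist and agree with these.\<close>

definition test_function :: "(real \<times> real \<Rightarrow> real) \<Rightarrow> bool" where
  "test_function \<psi> \<longleftrightarrow>
     (\<forall>k l z. (partial_t ^^ k) ((partial_s ^^ l) \<psi>) differentiable (at z)) \<and>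
     (\<exists>K. compact K \<and> K \<subseteq> interior unit_square \<and> (\<forall>z. z \<notin> K \<longrightarrow> \<psi> z = 0))"

definition weak_partial ::
  "nat \<Rightarrow> nat \<Rightarrow> (real \<times> real \<Rightarrow> real) \<Rightarrow> (real \<times> real \<Rightarrow> real) \<Rightarrow> bool" where
  "weak_partial k l f g \<longleftrightarrow>
     (\<forall>\<psi>. test_function \<psi> \<longrightarrow>
        inner_L2 f ((partial_t ^^ k) ((partial_s ^^ l) \<psi>)) = (-1) ^ (k + l) * inner_L2 g \<psi>)"

definition lincomb_fun ::
  "(nat \<Rightarrow> real \<times> real \<Rightarrow> real) \<Rightarrow> real Matrix.vec \<Rightarrow> real \<times> real \<Rightarrow> real" where
  "lincomb_fun b \<eta> z = (\<Sum>j<dim_vec \<eta>. (\<eta> $ j) * b j z)"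

text \<open>Linear independence of \<open>b 0, \<dots>, b (p - 1)\<close> as elements of \<open>L\<^sub>2\<close>, that is, modulo null sets.\<close>

definition lin_indep_L2 :: "nat \<Rightarrow> (nat \<Rightarrow> real \<times> real \<Rightarrow> real) \<Rightarrow> bool" where
  "lin_indep_L2 p b \<longleftrightarrow>
     (\<forall>c \<in> carrier_vec p.
        (AE z in lebesgue_on unit_square. lincomb_fun b c z = 0) \<longrightarrow> c = 0\<^sub>v p)"

definition l1_norm :: "real Matrix.vec \<Rightarrow> real" where
  "l1_norm v = (\<Sum>i<dim_vec v. \<bar>v $ i\<bar>)"

definition l2_norm :: "real Matrix.vec \<Rightarrow> real" where
  "l2_norm v = sqrt (\<Sum>i<dim_vec v. (v $ i)\<^sup>2)"

definition linf_norm :: "real Matrix.vec \<Rightarrow> real" where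
  "linf_norm v = Max (insert 0 ((\<lambda>i. \<bar>v $ i\<bar>) ` {..<dim_vec v}))"

definition emp_norm :: "real Matrix.vec \<Rightarrow> real" where
  "emp_norm u = sqrt ((\<Sum>i<dim_vec u. (u $ i)\<^sup>2) / real (dim_vec u))"

definition kron :: "real mat \<Rightarrow> real mat \<Rightarrow> real mat" where
  "kron A B = mat (dim_row A * dim_row B) (dim_col A * dim_col B)
     (\<lambda>(i, j). A $$ (i div dim_row B, j div dim_col B) * B $$ (i mod dim_row B, j mod dim_col B))"

definition diff_mat :: "nat \<Rightarrow> nat \<Rightarrow> real mat" where
  "diff_mat m d = mat (m - d) m
     (\<lambda>(i, j). if i \<le> j \<and> j \<le> i + d then (-1) ^ (j - i) * real (d choose (j - i)) else 0)"

text \<open>The Moore--Penrose pseudoinverse, given by the four Penrose equations.\<close>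

definition pinv :: "real mat \<Rightarrow> real mat" where
  "pinv A = (THE B. B \<in> carrier_mat (dim_col A) (dim_row A) \<and>
                    A * B * A = A \<and> B * A * B = B \<and>
                    (A * B)\<^sup>T = A * B \<and> (B * A)\<^sup>T = B * A)"

text \<open>The singular values of \<open>A\<close> are the square roots of the eigenvalues of \<open>A\<^sup>T A\<close>. This is the
  usual convention for matrices with at least as many rows as columns; a matrix with fewer rows
  than columns would pick up the additional value 0.\<close>

definition sigma_min :: "real mat \<Rightarrow> real" where
  "sigma_min A = Min (sqrt ` spectrum (A\<^sup>T * A))"

definition restr_phi :: "real mat \<Rightarrow> nat \<Rightarrow> real" where
  "restr_phi V S = (GREATEST \<phi>.
     \<forall>T c. T \<subseteq> {..<dim_col V} \<longrightarrow> card T \<le> S \<longrightarrow> c \<in> carrier_vec (card T) \<longrightarrow>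
       \<phi> * (l2_norm c)\<^sup>2 \<le> (l2_norm (submatrix V UNIV T *\<^sub>v c))\<^sup>2 / real (dim_row V))"

definition restr_theta :: "real mat \<Rightarrow> nat \<Rightarrow> nat \<Rightarrow> real" where
  "restr_theta V S S' = (LEAST \<theta>. \<theta> \<ge> 0 \<and>
     (\<forall>T T' c c'. T \<subseteq> {..<dim_col V} \<longrightarrow> T' \<subseteq> {..<dim_col V} \<longrightarrow> T \<inter> T' = {} \<longrightarrow>
       card T \<le> S \<longrightarrow> card T' \<le> S' \<longrightarrow> c \<in> carrier_vec (card T) \<longrightarrow> c' \<in> carrier_vec (card T') \<longrightarrow>
       \<bar>scalar_prod (submatrix V UNIV T *\<^sub>v c) (submatrix V UNIV T' *\<^sub>v c')\<bar> / real (dim_row V)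
         \<le> \<theta> * l2_norm c * l2_norm c'))"

end

theory Submission
  imports Defs
begin

unbundle no inner_syntax

text \<open>Write \<open>h\<close> for the difference of \<open>\<eta>_hat\<close> and \<open>\<eta>_star\<close>, and \<open>\<delta> = A h\<close>. On the event that the Gaussian
  scores \<open>X\<^sub>j\<^sup>T \<epsilon>\<close> are uniformly small, \<open>\<eta>_star\<close> is feasible, because Cauchy--Schwarz bounds the
  contribution of the approximation error to the scores by \<open>M E_b\<close>. Minimality then puts \<open>\<delta>\<close> in
  the cone where the part of \<open>\<delta>\<close> off the support \<open>T\<^sub>0\<close> of \<open>A \<eta>_star\<close> has the smaller
  \<open>\<ell>\<^sub>1\<close>-norm. Since \<open>pinv A\<close> is a left inverse of \<open>A\<close>, \<open>X h = V \<delta>\<close> and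
  \<open>\<langle>V c, X h\<rangle> / n = \<langle>pinv A c, X\<^sup>T X h / n\<rangle>\<close>, which is at most
  \<open>2 \<surd>L \<lambda> N_max \<parallel>c\<parallel> / sigma_min A\<close>. Taking for \<open>c\<close> the restriction of \<open>\<delta>\<close> to
  \<open>T\<^sub>0\<close> and the \<open>S\<close> largest other coordinates, and splitting the remaining coordinates into blocks
  of decreasing size, the restricted constants bound \<open>\<parallel>\<delta>\<parallel>\<close> as in the analysis of the Dantzig
  selector by Candes and Tao. Finally \<open>\<parallel>h\<parallel> \<le> \<parallel>\<delta>\<parallel> / sigma_min A\<close>, and \<open>\<parallel>X h\<parallel>\<^sup>2 / n\<close> is
  the inner product of \<open>h\<close> and \<open>X\<^sup>T X h / n\<close>.\<close>

subsection \<open>Smallest singular value and pseudoinverse\<close>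

lemma l2_norm_square: "(l2_norm v)\<^sup>2 = v \<bullet> v"
  by (simp add: l2_norm_def scalar_prod_def power2_eq_square sum_nonneg lessThan_atLeast0)

lemma l2_norm_nonneg [simp]: "0 \<le> l2_norm v"
  by (simp add: l2_norm_def sum_nonneg)

lemma l2_norm_eq_sqrt: "l2_norm v = sqrt (v \<bullet> v)"
  by (metis l2_norm_square l2_norm_nonneg real_sqrt_unique)

lemma scalar_prod_self_nonneg: "0 \<le> (v :: real Matrix.vec) \<bullet> v"
  by (metis l2_norm_square zero_le_power2)

lemma scalar_prod_self_eq_0:
  assumes "(v :: real Matrix.vec) \<in> carrier_vec n" "v \<bullet> v = 0"
  shows "v = 0\<^sub>v n"
proof (rule eq_vecI)
  show "dim_vec v = dim_vec (0\<^sub>v n :: real Matrix.vec)" using assms by simp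
  fix i assume "i < dim_vec (0\<^sub>v n :: real Matrix.vec)"
  then have "i \<in> {0..<dim_vec v}" using assms by simp
  moreover have "(\<Sum>i = 0..<dim_vec v. v $ i * v $ i) = 0"
    using assms by (simp add: scalar_prod_def)
  ultimately have "v $ i * v $ i = 0" by (subst (asm) sum_nonneg_eq_0_iff) auto
  then show "v $ i = 0\<^sub>v n $ i" using \<open>i \<in> _\<close> assms by simp
qed

lemma abs_scalar_prod_le:
  assumes "u \<in> carrier_vec n" "v \<in> carrier_vec n"
  shows "\<bar>u \<bullet> v\<bar> \<le> l2_norm u * l2_norm v"
proof -
  have "\<bar>u \<bullet> v\<bar> \<le> (\<Sum>i<n. \<bar>u $ i\<bar> * \<bar>v $ i\<bar>)"
    using assms by (auto simp: scalar_prod_def lessThan_atLeast0 abs_mult[symmetric] intro!: sum_abs)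
  also have "\<dots> \<le> l2_norm u * l2_norm v"
    using L2_set_mult_ineq[of "\<lambda>i. u $ i" "\<lambda>i. v $ i" "{..<n}"] assms
    by (simp add: l2_norm_def L2_set_def)
  finally show ?thesis .
qed

lemma scalar_prod_mult_mat_vec_eq_sum:
  assumes "G \<in> carrier_mat p p" "v \<in> carrier_vec p"
  shows "v \<bullet> (G *\<^sub>v v) = (\<Sum>i<p. \<Sum>j<p. v $ i * (G $$ (i, j) * v $ j))"
  using assms by (simp add: scalar_prod_def lessThan_atLeast0 sum_distrib_left)

text \<open>The unit sphere of R^p is coded by functions on \<open>nat\<close> that vanish from
  \<open>p\<close> on, inside the product topology. There it is a product of intervals [-1,1] and
  singletons {0}, compact by Tychonoff, cut by a closed condition.\<close>

lemma compact_unit_sphere_coordinates: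
  "compact {f. (\<forall>i. i < (p :: nat) \<longrightarrow> \<bar>f i\<bar> \<le> (1 :: real)) \<and> (\<forall>i\<ge>p. f i = 0) \<and> (\<Sum>i<p. (f i)\<^sup>2) = 1}"
proof -
  define I where "I = (\<lambda>i. if i < p then {-1..1} else {0 :: real})"
  have "compactin (product_topology (\<lambda>i. euclidean) UNIV) (PiE UNIV I)"
    by (auto simp: compactin_PiE I_def)
  then have K: "compact (PiE UNIV I)"
    by (simp add: euclidean_product_topology)
  have "continuous_on UNIV (\<lambda>f :: nat \<Rightarrow> real. \<Sum>i<p. (f i)\<^sup>2)"
    by (intro continuous_intros) simp
  then have "closed {f :: nat \<Rightarrow> real. (\<Sum>i<p. (f i)\<^sup>2) = 1}"
    by (intro closed_Collect_eq continuous_intros) auto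
  with K have "compact (PiE UNIV I \<inter> {f. (\<Sum>i<p. (f i)\<^sup>2) = 1})"
    by (rule compact_Int_closed)
  moreover have "PiE UNIV I \<inter> {f. (\<Sum>i<p. (f i)\<^sup>2) = 1} =
     {f. (\<forall>i. i < p \<longrightarrow> \<bar>f i\<bar> \<le> 1) \<and> (\<forall>i\<ge>p. f i = 0) \<and> (\<Sum>i<p. (f i)\<^sup>2) = 1}"
    by (fastforce simp: I_def PiE_def Pi_iff abs_le_iff not_less split: if_splits)
  ultimately show ?thesis by simp
qed

text \<open>A continuous quadratic form attains its minimum on the compact unit sphere; homogeneity
  of degree two carries the inequality from the sphere to all vectors.\<close>

lemma rayleigh_quotient_attains_min:
  fixes G :: "real mat"
  assumes G: "G \<in> carrier_mat p p" and p: "p > 0"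
  obtains v where "v \<in> carrier_vec p" "v \<bullet> v = 1"
    "\<And>u. u \<in> carrier_vec p \<Longrightarrow> (v \<bullet> (G *\<^sub>v v)) * (u \<bullet> u) \<le> u \<bullet> (G *\<^sub>v u)"
proof -
  define K :: "(nat \<Rightarrow> real) set"
    where "K = {f. (\<forall>i. i < p \<longrightarrow> \<bar>f i\<bar> \<le> 1) \<and> (\<forall>i\<ge>p. f i = 0) \<and> (\<Sum>i<p. (f i)\<^sup>2) = 1}"
  define q where "q f = (\<Sum>i<p. \<Sum>j<p. f i * (G $$ (i, j) * f j))" for f :: "nat \<Rightarrow> real"
  have q: "v \<bullet> (G *\<^sub>v v) = q (\<lambda>i. if i < p then v $ i else 0)" if "v \<in> carrier_vec p" for v
    using that G by (simp add: scalar_prod_mult_mat_vec_eq_sum q_def)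
  have K: "compact K" unfolding K_def by (rule compact_unit_sphere_coordinates)
  have "(\<lambda>i. if i = 0 then 1 else 0) \<in> K"
    using p by (auto simp: K_def if_distrib[of "\<lambda>x. x\<^sup>2"] cong: if_cong)
  then have "K \<noteq> {}" by blast
  moreover have "continuous_on K q"
    unfolding q_def
    by (intro continuous_intros continuous_on_subset[OF continuous_on_product_coordinates]) auto
  ultimately obtain f where f: "f \<in> K" and min: "\<And>g. g \<in> K \<Longrightarrow> q f \<le> q g"
    using continuous_attains_inf[OF K] by blast
  define v where "v = vec p f"
  have v: "v \<in> carrier_vec p" by (simp add: v_def)
  have fv: "(\<lambda>i. if i < p then v $ i else 0) = f"
    using f by (auto simp: v_def K_def)
  show ?thesis
  proof (rule that[OF v])
    show "v \<bullet> v = 1"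
      using f by (simp add: v_def K_def scalar_prod_def lessThan_atLeast0 power2_eq_square)
    fix u :: "real Matrix.vec" assume u: "u \<in> carrier_vec p"
    show "(v \<bullet> (G *\<^sub>v v)) * (u \<bullet> u) \<le> u \<bullet> (G *\<^sub>v u)"
    proof (cases "u \<bullet> u = 0")
      case True
      then have "u = 0\<^sub>v p" using u scalar_prod_self_eq_0 by blast
      then show ?thesis using True G by simp
    next
      case False
      define r where "r = l2_norm u"
      have r: "r > 0" "r\<^sup>2 = u \<bullet> u"
        using False scalar_prod_self_nonneg[of u] by (auto simp: r_def l2_norm_eq_sqrt)
      define g where "g = (\<lambda>i. if i < p then u $ i / r else 0)"
      have sum1: "(\<Sum>i<p. (g i)\<^sup>2) = 1"
      proof -
        have "(\<Sum>i<p. (g i)\<^sup>2) = (\<Sum>i<p. (u $ i)\<^sup>2) / r\<^sup>2"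
          by (simp add: g_def power_divide sum_divide_distrib)
        also have "(\<Sum>i<p. (u $ i)\<^sup>2) = u \<bullet> u"
          using u by (simp add: scalar_prod_def lessThan_atLeast0 power2_eq_square)
        finally show ?thesis using r False by simp
      qed
      have "\<bar>g i\<bar> \<le> 1" if "i < p" for i
      proof -
        have "(g i)\<^sup>2 \<le> (\<Sum>i<p. (g i)\<^sup>2)"
          by (rule member_le_sum) (use that in auto)
        then show ?thesis using sum1 by (simp add: abs_square_le_1)
      qed
      then have "g \<in> K" using sum1 by (auto simp: K_def g_def)
      then have "q f \<le> q g" by (rule min)
      also have "q g = q (\<lambda>i. if i < p then u $ i else 0) / r\<^sup>2"
        by (simp add: q_def g_def sum_divide_distrib power2_eq_square field_simps)
      finally have "q f * r\<^sup>2 \<le> q (\<lambda>i. if i < p then u $ i else 0)"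
        using zero_less_power[OF r(1), of 2] by (subst (asm) pos_le_divide_eq) auto
      then show ?thesis using q[OF v] q[OF u] fv r by simp
    qed
  qed
qed

text \<open>First variation. Moving the minimiser \<open>v\<close> along the residual
  \<open>g = G v - m v\<close> by a step \<open>c\<close> gives a polynomial in \<open>c\<close>
  without constant term that is nonnegative everywhere. Its linear coefficient is
  \<open>2 * (g \<bullet> g)\<close>, which therefore has to vanish.\<close>

lemma eigenvalue_rayleigh_min:
  fixes G :: "real mat"
  assumes G: "G \<in> carrier_mat p p" and sym: "G\<^sup>T = G"
    and v: "v \<in> carrier_vec p" "v \<bullet> v = 1"
    and min: "\<And>u. u \<in> carrier_vec p \<Longrightarrow> (v \<bullet> (G *\<^sub>v v)) * (u \<bullet> u) \<le> u \<bullet> (G *\<^sub>v u)"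
  shows "eigenvalue G (v \<bullet> (G *\<^sub>v v))"
proof -
  define m where "m = v \<bullet> (G *\<^sub>v v)"
  define g where "g = G *\<^sub>v v - m \<cdot>\<^sub>v v"
  have Gv: "G *\<^sub>v v \<in> carrier_vec p" using G v by simp
  have g: "g \<in> carrier_vec p" using Gv v by (simp add: g_def)
  have Gg: "G *\<^sub>v g \<in> carrier_vec p" using G g by simp
  \<comment> \<open>Symmetry of \<open>G\<close> merges the two cross terms of the quadratic
    form.\<close>
  have swap: "v \<bullet> (G *\<^sub>v g) = g \<bullet> (G *\<^sub>v v)"
    using transpose_vec_mult_scalar[OF G g v(1)] sym comm_scalar_prod[OF g Gv] by simp
  have gg: "g \<bullet> (G *\<^sub>v v) - m * (g \<bullet> v) = g \<bullet> g"
    using scalar_prod_minus_distrib[OF g Gv, of "m \<cdot>\<^sub>v v"] g v by (simp add: g_def)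
  define K where "K = g \<bullet> (G *\<^sub>v g) - m * (g \<bullet> g)"
  have quad: "0 \<le> 2 * c * (g \<bullet> g) + c\<^sup>2 * K" for c
  proof -
    have cg: "c \<cdot>\<^sub>v g \<in> carrier_vec p" using g by simp
    have "m * ((v + c \<cdot>\<^sub>v g) \<bullet> (v + c \<cdot>\<^sub>v g)) \<le> (v + c \<cdot>\<^sub>v g) \<bullet> (G *\<^sub>v (v + c \<cdot>\<^sub>v g))"
      unfolding m_def by (rule min) (use v g in auto)
    moreover have "(v + c \<cdot>\<^sub>v g) \<bullet> (v + c \<cdot>\<^sub>v g) = 1 + 2 * c * (g \<bullet> v) + c\<^sup>2 * (g \<bullet> g)"
      using v g cg by (simp add: add_scalar_prod_distrib[of _ p] scalar_prod_add_distrib[of _ p]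
          comm_scalar_prod[of v p g] power2_eq_square algebra_simps)
    moreover have "G *\<^sub>v (v + c \<cdot>\<^sub>v g) = G *\<^sub>v v + c \<cdot>\<^sub>v (G *\<^sub>v g)"
      using G v g cg by (simp add: mult_add_distrib_mat_vec[of _ p p] mult_mat_vec[of _ p p])
    moreover have "(v + c \<cdot>\<^sub>v g) \<bullet> (G *\<^sub>v v + c \<cdot>\<^sub>v (G *\<^sub>v g)) =
        m + 2 * c * (g \<bullet> (G *\<^sub>v v)) + c\<^sup>2 * (g \<bullet> (G *\<^sub>v g))"
      using v g cg Gv Gg swap by (simp add: add_scalar_prod_distrib[of _ p] scalar_prod_add_distrib[of _ p]
          m_def[symmetric] power2_eq_square algebra_simps)
    ultimately have "m * (1 + 2 * c * (g \<bullet> v) + c\<^sup>2 * (g \<bullet> g)) \<le> m + 2 * c * (g \<bullet> (G *\<^sub>v v)) + c\<^sup>2 * (g \<bullet> (G *\<^sub>v g))"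
      by simp
    then have "0 \<le> 2 * c * (g \<bullet> (G *\<^sub>v v) - m * (g \<bullet> v)) + c\<^sup>2 * K"
      by (simp add: K_def algebra_simps)
    then show ?thesis unfolding gg .
  qed
  have K: "K \<ge> 0" using min[OF g] by (simp add: K_def m_def)
  have "g \<bullet> g = 0"
  proof (rule ccontr)
    assume "g \<bullet> g \<noteq> 0"
    then have a: "g \<bullet> g > 0" using scalar_prod_self_nonneg[of g] by simp
    \<comment> \<open>The step solves \<open>c * (K + 1) = - (g \<bullet> g)\<close>, so the
      polynomial becomes \<open>c * ((g \<bullet> g) - c)\<close>, which is negative. The added 1
      keeps the denominator positive when \<open>K = 0\<close>.\<close>
    define c where "c = - ((g \<bullet> g) / (K + 1))"
    have "c < 0" using a K by (simp add: c_def)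
    have "c * K = - (g \<bullet> g) - c" using K by (simp add: c_def field_simps)
    then have "2 * (g \<bullet> g) + c * K = (g \<bullet> g) - c" by simp
    then have "2 * c * (g \<bullet> g) + c\<^sup>2 * K = c * ((g \<bullet> g) - c)"
      by (metis (no_types) distrib_left mult.assoc mult.commute power2_eq_square)
    also have "\<dots> < 0"
      using a \<open>c < 0\<close> by (intro mult_neg_pos) auto
    finally show False using quad[of c] by simp
  qed
  then have g0: "g = 0\<^sub>v p" using g scalar_prod_self_eq_0 by blast
  have "G *\<^sub>v v = m \<cdot>\<^sub>v v"
  proof (rule eq_vecI)
    fix i assume "i < dim_vec (m \<cdot>\<^sub>v v)"
    then have "i < p" using v by simp
    then have "g $ i = 0" by (simp add: g0)
    then show "(G *\<^sub>v v) $ i = (m \<cdot>\<^sub>v v) $ i" using \<open>i < p\<close> v Gv by (simp add: g_def)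
  qed (use v G in auto)
  moreover have "v \<noteq> 0\<^sub>v p" using v by auto
  ultimately have "eigenvector G v m" using v G by (simp add: eigenvector_def)
  then show ?thesis unfolding eigenvalue_def m_def by blast
qed

section \<open>Gram matrix and smallest singular value\<close>

lemma scalar_prod_gram:
  fixes A :: "real mat"
  assumes A: "A \<in> carrier_mat L p" and "u \<in> carrier_vec p" "v \<in> carrier_vec p"
  shows "u \<bullet> (A\<^sup>T * A *\<^sub>v v) = (A *\<^sub>v u) \<bullet> (A *\<^sub>v v)"
proof -
  have "(A *\<^sub>v u) \<bullet> (A *\<^sub>v v) = (A\<^sup>T *\<^sub>v (A *\<^sub>v v)) \<bullet> u"
    using assms by (subst transpose_vec_mult_scalar[OF A]) (auto intro: comm_scalar_prod[of _ L])
  also have "\<dots> = u \<bullet> (A\<^sup>T *\<^sub>v (A *\<^sub>v v))"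
    using assms by (intro comm_scalar_prod[of _ p]) auto
  also have "A\<^sup>T *\<^sub>v (A *\<^sub>v v) = A\<^sup>T * A *\<^sub>v v"
    using assms by (subst assoc_mult_mat_vec[of _ p L]) auto
  finally show ?thesis by simp
qed

text \<open>The Gram matrix has finitely many eigenvalues, all positive because \<open>A\<close> has
  trivial kernel, so the minimum is attained and positive. The Rayleigh minimum \<open>m\<close> is
  one of them; hence \<open>sigma_min A\<close> is at most \<open>sqrt m\<close>, and
  \<open>sqrt m\<close> already satisfies the lower bound.\<close>

lemma sigma_min_props:
  assumes A: "A \<in> carrier_mat L p" and p: "p > 0"
    and inj: "\<And>v. v \<in> carrier_vec p \<Longrightarrow> A *\<^sub>v v = 0\<^sub>v L \<Longrightarrow> v = 0\<^sub>v p"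
  shows "sigma_min A > 0"
    and "v \<in> carrier_vec p \<Longrightarrow> sigma_min A * l2_norm v \<le> l2_norm (A *\<^sub>v v)"
proof -
  let ?G = "A\<^sup>T * A"
  have G: "?G \<in> carrier_mat p p" using A by simp
  have sym: "?G\<^sup>T = ?G" using A by (simp add: transpose_mult[of _ p L _ p])
  obtain u where u: "u \<in> carrier_vec p" "u \<bullet> u = 1"
    "\<And>w. w \<in> carrier_vec p \<Longrightarrow> (u \<bullet> (?G *\<^sub>v u)) * (w \<bullet> w) \<le> w \<bullet> (?G *\<^sub>v w)"
    using rayleigh_quotient_attains_min[OF G p] by metis
  define m where "m = u \<bullet> (?G *\<^sub>v u)"
  have m: "m \<in> spectrum ?G"
    unfolding m_def spectrum_def using eigenvalue_rayleigh_min[OF G sym u] by simp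
  have fin: "finite (spectrum ?G)" using card_finite_spectrum[OF G] by simp
  have pos: "k > 0" if "k \<in> spectrum ?G" for k
  proof -
    from that obtain w where w: "w \<in> carrier_vec p" "w \<noteq> 0\<^sub>v p" "?G *\<^sub>v w = k \<cdot>\<^sub>v w"
      using G by (auto simp: spectrum_def eigenvalue_def eigenvector_def)
    have "k * (w \<bullet> w) = (A *\<^sub>v w) \<bullet> (A *\<^sub>v w)"
      using scalar_prod_gram[OF A w(1) w(1)] w by simp
    moreover have "(A *\<^sub>v w) \<bullet> (A *\<^sub>v w) \<noteq> 0"
      using inj[OF w(1)] scalar_prod_self_eq_0[of "A *\<^sub>v w" L] w A by auto
    ultimately have "k * (w \<bullet> w) > 0"
      using scalar_prod_self_nonneg[of "A *\<^sub>v w"] by linarith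
    then show ?thesis
      using scalar_prod_self_nonneg[of w] by (simp add: zero_less_mult_iff)
  qed
  have "sigma_min A \<in> sqrt ` spectrum ?G"
    unfolding sigma_min_def using fin m by (intro Min_in) auto
  then show s0: "sigma_min A > 0" using pos by auto
  have le: "sigma_min A \<le> sqrt m"
    unfolding sigma_min_def using fin m by (intro Min_le) auto
  assume v: "v \<in> carrier_vec p"
  have "sqrt m * l2_norm v = sqrt (m * (v \<bullet> v))"
    by (simp add: l2_norm_eq_sqrt real_sqrt_mult)
  also have "\<dots> \<le> l2_norm (A *\<^sub>v v)"
    using u(3)[OF v] scalar_prod_gram[OF A v v] by (simp add: m_def l2_norm_eq_sqrt)
  finally show "sigma_min A * l2_norm v \<le> l2_norm (A *\<^sub>v v)"
    using mult_right_mono[OF le l2_norm_nonneg[of v]] by linarith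
qed

text \<open>A nonzero kernel vector is a linear dependence between the columns, against full rank.
  Independence concerns the set of columns, so repeated columns are excluded first: they would leave
  fewer than \<open>p\<close> vectors to make up the rank.\<close>

lemma rank_full_imp_injective:
  fixes A :: "real mat"
  assumes A: "A \<in> carrier_mat L p" and rank: "vec_space.rank L A = p"
    and v: "v \<in> carrier_vec p" "A *\<^sub>v v = 0\<^sub>v L"
  shows "v = 0\<^sub>v p"
proof (rule ccontr)
  assume nz: "v \<noteq> 0\<^sub>v p"
  interpret vec_space "TYPE(real)" L .
  have dist: "distinct (cols A)"
  proof (rule ccontr)
    assume "\<not> distinct (cols A)"
    then have *: "card (set (cols A)) < p"
      using A card_distinct[of "cols A"] card_length[of "cols A"] by fastforce
    obtain S where S: "maximal S (\<lambda>T. T \<subseteq> set (cols A) \<and> lin_indpt T)"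
      using maximal_exists[of "(\<lambda>T. T \<subseteq> set (cols A) \<and> lin_indpt T)" "card (set (cols A))" "{}"]
      by (meson List.finite_set card_mono empty_iff empty_subsetI finite_lin_indpt2 rev_finite_subset)
    then have "card S \<le> card (set (cols A))" by (simp add: card_mono maximal_def)
    then show False using rank_card_indpt[OF A S] * rank by simp
  qed
  show False using lin_depI[OF A v(1) nz v(2) dist] full_rank_lin_indpt[OF A rank dist] by simp
qed

text \<open>Penrose's argument: the symmetry equations let factors change places under
  transposition, which gives \<open>A * B = A * C\<close> and \<open>B * A = C * A\<close>; then
  \<open>B * A * B\<close> turns into \<open>C * A * C\<close>. This justifies the definite
  description in \<open>pinv\<close>.\<close>

lemma penrose_unique:
  fixes A B C :: "real mat"
  assumes A: "A \<in> carrier_mat r c" and B: "B \<in> carrier_mat c r" and C: "C \<in> carrier_mat c r"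
    and b: "A * B * A = A" "B * A * B = B" "(A * B)\<^sup>T = A * B" "(B * A)\<^sup>T = B * A"
    and c: "A * C * A = A" "C * A * C = C" "(A * C)\<^sup>T = A * C" "(C * A)\<^sup>T = C * A"
  shows "B = C"
proof -
  note car = A B C mult_carrier_mat
  have AB: "A * B = A * C"
  proof -
    have "A * B = (A * C * A) * B" using c by simp
    also have "\<dots> = (A * C) * (A * B)" by (rule assoc_mult_mat) (use car in auto)
    also have "\<dots> = (A * C)\<^sup>T * (A * B)\<^sup>T" using b c by simp
    also have "\<dots> = ((A * B) * (A * C))\<^sup>T" by (rule transpose_mult[symmetric]) (use car in auto)
    also have "(A * B) * (A * C) = (A * B * A) * C" by (rule assoc_mult_mat[symmetric]) (use car in auto)
    finally show ?thesis using b c by simp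
  qed
  have BA: "B * A = C * A"
  proof -
    have "B * A = B * (A * (C * A))" using c A B C by (simp add: assoc_mult_mat[of _ r c])
    also have "\<dots> = (B * A) * (C * A)" by (rule assoc_mult_mat[symmetric]) (use car in auto)
    also have "\<dots> = (B * A)\<^sup>T * (C * A)\<^sup>T" using b c by simp
    also have "\<dots> = ((C * A) * (B * A))\<^sup>T" by (rule transpose_mult[symmetric]) (use car in auto)
    also have "(C * A) * (B * A) = C * (A * B * A)"
      using assoc_mult_mat[OF C A, of "B * A" c] assoc_mult_mat[OF A B A] A B by simp
    finally show ?thesis using b c by simp
  qed
  have "B = B * (A * B)" using b A B by (simp add: assoc_mult_mat[of _ c r])
  also have "\<dots> = B * (A * C)" using AB by simp
  also have "\<dots> = (B * A) * C" by (rule assoc_mult_mat[symmetric]) (use car in auto)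
  also have "\<dots> = C" using BA c by simp
  finally show ?thesis .
qed

text \<open>With trivial kernel the Gram matrix has an inverse \<open>H\<close>. The classical
  formula \<open>H * A\<^sup>T\<close> satisfies the four Penrose equations, and uniqueness
  identifies it with \<open>pinv A\<close>.\<close>

lemma pinv_full_column_rank:
  assumes A: "A \<in> carrier_mat L p"
    and inj: "\<And>v. v \<in> carrier_vec p \<Longrightarrow> A *\<^sub>v v = 0\<^sub>v L \<Longrightarrow> v = 0\<^sub>v p"
  shows "pinv A \<in> carrier_mat p L" "pinv A * A = 1\<^sub>m p" "(A * pinv A)\<^sup>T = A * pinv A"
proof -
  let ?G = "A\<^sup>T * A"
  have G: "?G \<in> carrier_mat p p" using A by simp
  have sym: "?G\<^sup>T = ?G" using A by (simp add: transpose_mult[of _ p L _ p])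
  have "det ?G \<noteq> 0"
  proof
    assume "det ?G = 0"
    then obtain w where w: "w \<in> carrier_vec p" "w \<noteq> 0\<^sub>v p" "?G *\<^sub>v w = 0\<^sub>v p"
      using det_0_iff_vec_prod_zero_field[OF G] by auto
    then have "(A *\<^sub>v w) \<bullet> (A *\<^sub>v w) = 0" using scalar_prod_gram[OF A w(1) w(1)] by simp
    then show False using scalar_prod_self_eq_0[of "A *\<^sub>v w" L] inj[OF w(1)] w A by auto
  qed
  from det_non_zero_imp_unit[OF G this, unfolded Units_def, of "()"]
  obtain H where H: "H \<in> carrier_mat p p" "H * ?G = 1\<^sub>m p" "?G * H = 1\<^sub>m p"
    by (auto simp: ring_mat_def)
  have Hsym: "H\<^sup>T = H"
  proof -
    have "H\<^sup>T = H\<^sup>T * (?G * H)" using H by simp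
    also have "\<dots> = (H\<^sup>T * ?G) * H" by (rule assoc_mult_mat[symmetric]) (use H G in auto)
    also have "H\<^sup>T * ?G = (?G * H)\<^sup>T" using sym transpose_mult[OF G H(1)] by simp
    finally show ?thesis using H by simp
  qed
  define B where "B = H * A\<^sup>T"
  have B: "B \<in> carrier_mat p L" using H A by (simp add: B_def)
  have BA: "B * A = 1\<^sub>m p" using H A by (simp add: B_def assoc_mult_mat[of _ p p _ L])
  have ABsym: "(A * B)\<^sup>T = A * B"
  proof -
    have "B\<^sup>T = A * H" using transpose_mult[OF H(1), of "A\<^sup>T" L] A by (simp add: B_def Hsym)
    then have "(A * B)\<^sup>T = (A * H) * A\<^sup>T" using transpose_mult[OF A B] by simp
    also have "\<dots> = A * B" unfolding B_def by (rule assoc_mult_mat) (use A H in auto)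
    finally show ?thesis .
  qed
  have pen: "A * B * A = A" "B * A * B = B" "(B * A)\<^sup>T = B * A"
    using A B BA by (simp_all add: assoc_mult_mat[of _ L p])
  have "pinv A = B"
    unfolding pinv_def
  proof (rule the_equality)
    show "B \<in> carrier_mat (dim_col A) (dim_row A) \<and> A * B * A = A \<and> B * A * B = B \<and>
        (A * B)\<^sup>T = A * B \<and> (B * A)\<^sup>T = B * A"
      using A B pen ABsym by auto
  next
    fix C assume "C \<in> carrier_mat (dim_col A) (dim_row A) \<and> A * C * A = A \<and> C * A * C = C \<and>
        (A * C)\<^sup>T = A * C \<and> (C * A)\<^sup>T = C * A"
    then show "C = B" using penrose_unique[OF A _ B _ _ _ _ pen(1,2) ABsym pen(3), of C] A by auto
  qed
  then show "pinv A \<in> carrier_mat p L" "pinv A * A = 1\<^sub>m p" "(A * pinv A)\<^sup>T = A * pinv A"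
    using B BA ABsym by auto
qed

text \<open>\<open>A * pinv A\<close> is symmetric and idempotent, an orthogonal projection, so it
  does not increase the norm; \<open>sigma_min A\<close> then compares
  \<open>pinv A *\<^sub>v c\<close> with its image under \<open>A\<close>.\<close>

lemma l2_norm_pinv_le:
  assumes A: "A \<in> carrier_mat L p" and p: "p > 0"
    and inj: "\<And>v. v \<in> carrier_vec p \<Longrightarrow> A *\<^sub>v v = 0\<^sub>v L \<Longrightarrow> v = 0\<^sub>v p"
    and c: "c \<in> carrier_vec L"
  shows "sigma_min A * l2_norm (pinv A *\<^sub>v c) \<le> l2_norm c"
proof -
  note B = pinv_full_column_rank[OF A inj]
  let ?g = "pinv A *\<^sub>v c"
  have g: "?g \<in> carrier_vec p" using B c by simp
  have Ag: "A *\<^sub>v ?g \<in> carrier_vec L" using A g by simp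
  have P: "A *\<^sub>v ?g = (A * pinv A)\<^sup>T *\<^sub>v c" using A B c by (simp add: assoc_mult_mat_vec[of _ L p])
  have "(A *\<^sub>v ?g) \<bullet> (A *\<^sub>v ?g) = c \<bullet> ((A * pinv A) *\<^sub>v (A *\<^sub>v ?g))"
    by (subst P, rule transpose_vec_mult_scalar[of _ L L]) (use A B c in auto)
  also have "(A * pinv A) *\<^sub>v (A *\<^sub>v ?g) = A *\<^sub>v ((pinv A * A) *\<^sub>v ?g)"
    using assoc_mult_mat_vec[OF A B(1) Ag] assoc_mult_mat_vec[OF B(1) A g] by simp
  also have "\<dots> = A *\<^sub>v ?g" using B g by simp
  finally have "(l2_norm (A *\<^sub>v ?g))\<^sup>2 \<le> l2_norm c * l2_norm (A *\<^sub>v ?g)"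
    using abs_scalar_prod_le[OF c Ag] by (simp add: l2_norm_square)
  then have "l2_norm (A *\<^sub>v ?g) \<le> l2_norm c"
    by (metis l2_norm_nonneg mult_le_cancel_right order_le_less power2_eq_square not_less)
  then show ?thesis using sigma_min_props(2)[OF A p inj g] by simp
qed

subsection \<open>Restricted eigenvalue and orthogonality constants\<close>

lemma bij_betw_pick:
  assumes "finite T"
  shows "bij_betw (pick T) {..<card T} T"
proof (rule bij_betw_imageI)
  have "\<And>i j. i < j \<Longrightarrow> j < card T \<Longrightarrow> pick T i < pick T j"
    using pick_mono_le by blast
  then show inj: "inj_on (pick T) {..<card T}"
    by (intro linorder_inj_onI) (auto simp: less_imp_neq)
  show "pick T ` {..<card T} = T"
    using assms inj pick_in_set_le by (intro card_subset_eq) (auto simp: card_image)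
qed

text \<open>The restricted constants speak of column submatrices applied to short vectors. Padding
  with zeros off \<open>T\<close> replaces these by the full matrix, so that vectors with different
  supports can be added.\<close>

lemma submatrix_UNIV_mult_vec:
  fixes V :: "real mat"
  assumes V: "V \<in> carrier_mat n L" and T: "T \<subseteq> {..<L}"
  shows "submatrix V UNIV T *\<^sub>v vec (card T) (\<lambda>i. f (pick T i)) =
    V *\<^sub>v vec L (\<lambda>j. if j \<in> T then f j else 0)"
proof (rule eq_vecI)
  have cols: "{j. j < dim_col V \<and> j \<in> T} = T" using V T by auto
  have rows: "{i. i < dim_row V \<and> i \<in> UNIV} = {..<n}" using V by auto
  show "dim_vec (submatrix V UNIV T *\<^sub>v vec (card T) (\<lambda>i. f (pick T i))) =
     dim_vec (V *\<^sub>v vec L (\<lambda>j. if j \<in> T then f j else 0))"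
    using V by (simp add: dim_submatrix)
  fix i assume "i < dim_vec (V *\<^sub>v vec L (\<lambda>j. if j \<in> T then f j else 0))"
  then have i: "i < n" using V by simp
  have fin: "finite T" using T finite_subset by blast
  have "(submatrix V UNIV T *\<^sub>v vec (card T) (\<lambda>i. f (pick T i))) $ i
      = (\<Sum>k<card T. V $$ (i, pick T k) * f (pick T k))"
    using i V cols rows
    by (simp add: scalar_prod_def lessThan_atLeast0 submatrix_def pick_UNIV)
  also have "\<dots> = (\<Sum>j\<in>T. V $$ (i, j) * f j)"
    by (rule sum.reindex_bij_betw[OF bij_betw_pick[OF fin]])
  also have "\<dots> = (\<Sum>j<L. V $$ (i, j) * (if j \<in> T then f j else 0))"
    using T by (intro sum.mono_neutral_cong_left) auto
  finally show "(submatrix V UNIV T *\<^sub>v vec (card T) (\<lambda>i. f (pick T i))) $ i =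
      (V *\<^sub>v vec L (\<lambda>j. if j \<in> T then f j else 0)) $ i"
    using i V by (simp add: scalar_prod_def lessThan_atLeast0)
qed

lemma l2_norm_vec_pick:
  assumes "finite T"
  shows "l2_norm (vec (card T) (\<lambda>i. f (pick T i))) = sqrt (\<Sum>j\<in>T. (f j)\<^sup>2)"
  using sum.reindex_bij_betw[OF bij_betw_pick[OF assms], of "\<lambda>j. (f j)\<^sup>2"]
  by (simp add: l2_norm_def)

lemma vec_eq_vec_pick:
  assumes "finite T" "c \<in> carrier_vec (card T)"
  obtains f where "c = vec (card T) (\<lambda>i. f (pick T i))"
proof (rule that)
  show "c = vec (card T) (\<lambda>i. c $ the_inv_into {..<card T} (pick T) (pick T i))"
    using assms bij_betw_imp_inj_on[OF bij_betw_pick[OF assms(1)]]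
    by (intro eq_vecI) (auto simp: the_inv_into_f_f)
qed

text \<open>Cauchy--Schwarz in each row; the factor is the Frobenius norm. It serves to exhibit one
  admissible constant for \<open>restr_theta\<close>.\<close>

lemma l2_norm_mult_mat_vec_le:
  fixes V :: "real mat"
  assumes V: "V \<in> carrier_mat n L" and w: "w \<in> carrier_vec L"
  shows "l2_norm (V *\<^sub>v w) \<le> sqrt (\<Sum>i<n. row V i \<bullet> row V i) * l2_norm w"
proof -
  have "(\<Sum>i<n. (row V i \<bullet> w)\<^sup>2) \<le> (\<Sum>i<n. (row V i \<bullet> row V i) * (l2_norm w)\<^sup>2)"
  proof (rule sum_mono)
    fix i assume "i \<in> {..<n}"
    then have "row V i \<in> carrier_vec L" using V by (metis row_carrier carrier_matD(2))
    from power_mono[OF abs_scalar_prod_le[OF this w], of 2]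
    show "(row V i \<bullet> w)\<^sup>2 \<le> (row V i \<bullet> row V i) * (l2_norm w)\<^sup>2"
      by (simp add: power_mult_distrib l2_norm_square)
  qed
  then have "(l2_norm (V *\<^sub>v w))\<^sup>2 \<le> (\<Sum>i<n. row V i \<bullet> row V i) * (l2_norm w)\<^sup>2"
    using V by (simp add: l2_norm_def sum_nonneg sum_distrib_right)
  then show ?thesis
    by (metis l2_norm_nonneg real_sqrt_abs real_sqrt_le_iff real_sqrt_mult abs_of_nonneg)
qed

text \<open>\<open>GREATEST\<close> yields the intended constant only if a greatest element exists.
  The admissible set contains 0, is bounded above, and its defining inequalities pass to the
  supremum, so the supremum is admissible and equals \<open>restr_phi\<close>.\<close>

lemma restr_phi_le:
  assumes V: "V \<in> carrier_mat n L" and L: "L \<ge> 1" and S: "S \<ge> 1"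
    and T: "T \<subseteq> {..<L}" "card T \<le> S"
  shows "restr_phi V S * (\<Sum>j\<in>T. (f j)\<^sup>2)
    \<le> (l2_norm (V *\<^sub>v vec L (\<lambda>j. if j \<in> T then f j else 0)))\<^sup>2 / real n"
proof -
  define Q where "Q = (\<lambda>\<phi>.
     \<forall>T c. T \<subseteq> {..<dim_col V} \<longrightarrow> card T \<le> S \<longrightarrow> c \<in> carrier_vec (card T) \<longrightarrow>
       \<phi> * (l2_norm c)\<^sup>2 \<le> (l2_norm (submatrix V UNIV T *\<^sub>v c))\<^sup>2 / real (dim_row V))"
  \<comment> \<open>A single column with coefficient 1 bounds every admissible value;
    \<open>L \<ge> 1\<close> and \<open>S \<ge> 1\<close> make this test available.\<close>
  have bdd: "\<phi> \<le> (l2_norm (submatrix V UNIV {0} *\<^sub>v vec 1 (\<lambda>_. 1)))\<^sup>2 / real n" if "Q \<phi>" for \<phi>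
  proof -
    have "\<phi> * (l2_norm (vec 1 (\<lambda>_. 1)))\<^sup>2 \<le> (l2_norm (submatrix V UNIV {0} *\<^sub>v vec 1 (\<lambda>_. 1)))\<^sup>2 / real n"
      using that[unfolded Q_def, rule_format, of "{0}" "vec 1 (\<lambda>_. 1)"] V L S by auto
    then show ?thesis by (simp add: l2_norm_def)
  qed
  then have bdd': "bdd_above (Collect Q)" by (intro bdd_aboveI) auto
  have "Q 0" by (simp add: Q_def)
  define m where "m = Sup (Collect Q)"
  have "Q m"
    unfolding Q_def
  proof (intro allI impI)
    fix T and c :: "real Matrix.vec"
    assume *: "T \<subseteq> {..<dim_col V}" "card T \<le> S" "c \<in> carrier_vec (card T)"
    let ?r = "(l2_norm (submatrix V UNIV T *\<^sub>v c))\<^sup>2 / real (dim_row V)"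
    show "m * (l2_norm c)\<^sup>2 \<le> ?r"
    proof (cases "l2_norm c = 0")
      case False
      then have pos: "(l2_norm c)\<^sup>2 > 0" by simp
      have "m \<le> ?r / (l2_norm c)\<^sup>2"
        unfolding m_def
      proof (rule cSup_least)
        show "Collect Q \<noteq> {}" using \<open>Q 0\<close> by blast
        fix \<phi> assume "\<phi> \<in> Collect Q"
        then have "\<phi> * (l2_norm c)\<^sup>2 \<le> ?r" using * unfolding Q_def by blast
        then show "\<phi> \<le> ?r / (l2_norm c)\<^sup>2" using pos by (subst pos_le_divide_eq)
      qed
      then show ?thesis using pos by (subst (asm) pos_le_divide_eq)
    qed simp
  qed
  moreover have "restr_phi V S = m"
    unfolding restr_phi_def Q_def[symmetric] m_def
    using calculation[unfolded m_def] bdd' by (intro Greatest_equality) (auto intro: cSup_upper)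
  ultimately have "Q (restr_phi V S)" by simp
  then have "restr_phi V S * (l2_norm (vec (card T) (\<lambda>i. f (pick T i))))\<^sup>2
    \<le> (l2_norm (submatrix V UNIV T *\<^sub>v vec (card T) (\<lambda>i. f (pick T i))))\<^sup>2 / real (dim_row V)"
    using T V unfolding Q_def by auto
  then show ?thesis
    using V T finite_subset[OF T(1)]
    by (simp add: submatrix_UNIV_mult_vec[OF V T(1)] l2_norm_vec_pick sum_nonneg)
qed

text \<open>The same argument as for \<open>restr_phi\<close>, with infimum in place of supremum:
  the admissible set is nonempty by the Frobenius bound, bounded below by 0, and contains its
  infimum.\<close>

lemma restr_theta_props:
  assumes V: "V \<in> carrier_mat n L"
  shows "restr_theta V S S' \<ge> 0"
    and "T \<subseteq> {..<L} \<Longrightarrow> T' \<subseteq> {..<L} \<Longrightarrow> T \<inter> T' = {} \<Longrightarrow> card T \<le> S \<Longrightarrow> card T' \<le> S' \<Longrightarrow>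
      \<bar>(V *\<^sub>v vec L (\<lambda>j. if j \<in> T then f j else 0)) \<bullet> (V *\<^sub>v vec L (\<lambda>j. if j \<in> T' then g j else 0))\<bar> / real n
      \<le> restr_theta V S S' * sqrt (\<Sum>j\<in>T. (f j)\<^sup>2) * sqrt (\<Sum>j\<in>T'. (g j)\<^sup>2)"
proof -
  define Q where "Q = (\<lambda>\<theta>. \<theta> \<ge> 0 \<and>
     (\<forall>T T' c c'. T \<subseteq> {..<dim_col V} \<longrightarrow> T' \<subseteq> {..<dim_col V} \<longrightarrow> T \<inter> T' = {} \<longrightarrow>
       card T \<le> S \<longrightarrow> card T' \<le> S' \<longrightarrow> c \<in> carrier_vec (card T) \<longrightarrow> c' \<in> carrier_vec (card T') \<longrightarrow>
       \<bar>scalar_prod (submatrix V UNIV T *\<^sub>v c) (submatrix V UNIV T' *\<^sub>v c')\<bar> / real (dim_row V)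
         \<le> \<theta> * l2_norm c * l2_norm c'))"
  define F where "F = sqrt (\<Sum>i<n. row V i \<bullet> row V i)"
  have F: "F \<ge> 0" by (simp add: F_def sum_nonneg scalar_prod_self_nonneg)
  have sub: "l2_norm (submatrix V UNIV T *\<^sub>v c) \<le> F * l2_norm c"
    "submatrix V UNIV T *\<^sub>v c \<in> carrier_vec n"
    if T: "T \<subseteq> {..<L}" and c: "c \<in> carrier_vec (card T)" for T c
  proof -
    have fin: "finite T" using T finite_subset by blast
    obtain f where f: "c = vec (card T) (\<lambda>i. f (pick T i))" using vec_eq_vec_pick[OF fin c] .
    let ?w = "vec L (\<lambda>j. if j \<in> T then f j else 0)"
    have "l2_norm ?w = sqrt (\<Sum>j\<in>T. (f j)\<^sup>2)"
      using T unfolding l2_norm_def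
      by (auto intro!: arg_cong[where f = sqrt] sum.mono_neutral_cong_right)
    then have "l2_norm ?w = l2_norm c" using fin by (simp add: f l2_norm_vec_pick)
    then show "l2_norm (submatrix V UNIV T *\<^sub>v c) \<le> F * l2_norm c"
      using l2_norm_mult_mat_vec_le[OF V, of ?w] submatrix_UNIV_mult_vec[OF V T, of f]
      by (simp add: F_def f)
    show "submatrix V UNIV T *\<^sub>v c \<in> carrier_vec n"
      using submatrix_UNIV_mult_vec[OF V T, of f] V by (simp add: f)
  qed
  have "Q (F * F / n)"
    unfolding Q_def
  proof (intro conjI allI impI)
    fix T T' and c c' :: "real Matrix.vec"
    assume *: "T \<subseteq> {..<dim_col V}" "T' \<subseteq> {..<dim_col V}" "c \<in> carrier_vec (card T)" "c' \<in> carrier_vec (card T')"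
    have "\<bar>(submatrix V UNIV T *\<^sub>v c) \<bullet> (submatrix V UNIV T' *\<^sub>v c')\<bar>
      \<le> l2_norm (submatrix V UNIV T *\<^sub>v c) * l2_norm (submatrix V UNIV T' *\<^sub>v c')"
      using * V sub(2) by (intro abs_scalar_prod_le) auto
    also have "\<dots> \<le> (F * l2_norm c) * (F * l2_norm c')"
      using * V sub(1) F by (intro mult_mono) auto
    finally show "\<bar>(submatrix V UNIV T *\<^sub>v c) \<bullet> (submatrix V UNIV T' *\<^sub>v c')\<bar> / real (dim_row V)
         \<le> F * F / n * l2_norm c * l2_norm c'"
      using V by (simp add: divide_right_mono mult_ac)
  qed (use F in simp)
  have bdd: "bdd_below (Collect Q)" by (intro bdd_belowI[of _ 0]) (simp add: Q_def)
  define m where "m = Inf (Collect Q)"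
  have "Q m"
    unfolding Q_def
  proof (intro conjI allI impI)
    show "0 \<le> m"
      unfolding m_def
      using \<open>Q (F * F / n)\<close> by (intro cInf_greatest) (blast, simp add: Q_def)
    fix T T' and c c' :: "real Matrix.vec"
    assume *: "T \<subseteq> {..<dim_col V}" "T' \<subseteq> {..<dim_col V}" "T \<inter> T' = {}" "card T \<le> S" "card T' \<le> S'"
      "c \<in> carrier_vec (card T)" "c' \<in> carrier_vec (card T')"
    let ?r = "\<bar>(submatrix V UNIV T *\<^sub>v c) \<bullet> (submatrix V UNIV T' *\<^sub>v c')\<bar> / real (dim_row V)"
    have le: "?r \<le> \<theta> * (l2_norm c * l2_norm c')" if "Q \<theta>" for \<theta>
      using that * unfolding Q_def by (simp add: mult.assoc)
    show "?r \<le> m * l2_norm c * l2_norm c'"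
    proof (cases "l2_norm c * l2_norm c' = 0")
      \<comment> \<open>Division by the norms is impossible here, but any one admissible constant
        already forces \<open>?r \<le> 0\<close>.\<close>
      case True
      then have "?r \<le> 0" using le[OF \<open>Q (F * F / n)\<close>] by (simp only: mult_zero_right)
      then show ?thesis using True by (simp only: mult.assoc mult_zero_right)
    next
      case False
      then have pos: "l2_norm c * l2_norm c' > 0"
        by (metis l2_norm_nonneg less_eq_real_def mult_nonneg_nonneg)
      have "?r / (l2_norm c * l2_norm c') \<le> m"
        unfolding m_def
      proof (rule cInf_greatest)
        show "Collect Q \<noteq> {}" using \<open>Q (F * F / n)\<close> by blast
        fix \<theta> assume "\<theta> \<in> Collect Q"
        then show "?r / (l2_norm c * l2_norm c') \<le> \<theta>" using le pos by (subst pos_divide_le_eq) auto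
      qed
      then show ?thesis using pos by (subst (asm) pos_divide_le_eq) (auto simp: mult.assoc)
    qed
  qed
  moreover have "restr_theta V S S' = m"
    unfolding restr_theta_def Q_def[symmetric] m_def
    using calculation[unfolded m_def] bdd by (intro Least_equality) (auto intro: cInf_lower)
  ultimately have Q: "Q (restr_theta V S S')" by simp
  then show "restr_theta V S S' \<ge> 0" by (simp add: Q_def)
  assume T: "T \<subseteq> {..<L}" "T' \<subseteq> {..<L}" "T \<inter> T' = {}" "card T \<le> S" "card T' \<le> S'"
  have "\<bar>(submatrix V UNIV T *\<^sub>v vec (card T) (\<lambda>i. f (pick T i))) \<bullet>
         (submatrix V UNIV T' *\<^sub>v vec (card T') (\<lambda>i. g (pick T' i)))\<bar> / real (dim_row V)
    \<le> restr_theta V S S' * l2_norm (vec (card T) (\<lambda>i. f (pick T i))) * l2_norm (vec (card T') (\<lambda>i. g (pick T' i)))"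
    using Q T V unfolding Q_def by auto
  then show "\<bar>(V *\<^sub>v vec L (\<lambda>j. if j \<in> T then f j else 0)) \<bullet> (V *\<^sub>v vec L (\<lambda>j. if j \<in> T' then g j else 0))\<bar> / real n
      \<le> restr_theta V S S' * sqrt (\<Sum>j\<in>T. (f j)\<^sup>2) * sqrt (\<Sum>j\<in>T'. (g j)\<^sup>2)"
    using V finite_subset[OF T(1)] finite_subset[OF T(2)]
    by (simp add: submatrix_UNIV_mult_vec[OF V T(1)] submatrix_UNIV_mult_vec[OF V T(2)] l2_norm_vec_pick)
qed

subsection \<open>Sparse vectors in the cone\<close>

text \<open>Greedy choice: adding a largest remaining element keeps every chosen value at least as
  large as every unchosen one.\<close>

lemma ex_largest_subset:
  fixes g :: "'a \<Rightarrow> real"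
  assumes "finite R" "k \<le> card R"
  shows "\<exists>B\<subseteq>R. card B = k \<and> (\<forall>i\<in>B. \<forall>j\<in>R - B. g j \<le> g i)"
  using assms(2)
proof (induction k)
  case (Suc k)
  then obtain B where B: "B \<subseteq> R" "card B = k" "\<forall>i\<in>B. \<forall>j\<in>R - B. g j \<le> g i" by auto
  have fin: "finite (R - B)" "finite B" using assms(1) B finite_subset by auto
  have "R - B \<noteq> {}" using B Suc.prems by auto
  then obtain m where m: "m \<in> R - B" "\<And>j. j \<in> R - B \<Longrightarrow> g j \<le> g m"
  proof -
    have "Max (g ` (R - B)) \<in> g ` (R - B)" using fin \<open>R - B \<noteq> {}\<close> by (intro Max_in) auto
    then obtain m where "m \<in> R - B" "Max (g ` (R - B)) = g m" by blast
    then show thesis using fin Max_ge[of "g ` (R - B)"] by (intro that[of m]) auto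
  qed
  then show ?case using B fin
    by (intro exI[of _ "insert m B"]) auto
qed auto

text \<open>The decomposition into blocks of decreasing size, in inductive form. The entries left
  after removing the \<open>S\<close> largest are bounded by the mean of the removed block, so each
  block is paid for by the l1 mass of its predecessor, and only the first one costs
  \<open>sqrt S * a\<close>. \<open>F\<close> abstracts the inner product with a fixed
  vector.\<close>

lemma additive_block_bound:
  fixes d :: "'a \<Rightarrow> real" and F :: "'a set \<Rightarrow> real"
  assumes "finite R" and S: "S \<ge> 1" and \<kappa>: "\<kappa> \<ge> 0"
    and "a \<ge> 0" "\<And>j. j \<in> R \<Longrightarrow> \<bar>d j\<bar> \<le> a"
    and "\<And>B C. B \<inter> C = {} \<Longrightarrow> B \<union> C \<subseteq> R \<Longrightarrow> F (B \<union> C) = F B + F C"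
    and "\<And>B. B \<subseteq> R \<Longrightarrow> card B \<le> S \<Longrightarrow> \<bar>F B\<bar> \<le> \<kappa> * sqrt (\<Sum>j\<in>B. (d j)\<^sup>2)"
  shows "\<bar>F R\<bar> \<le> \<kappa> * (sqrt (real S) * a + (\<Sum>j\<in>R. \<bar>d j\<bar>) / sqrt (real S))"
  using assms(1,4-7)
proof (induction R arbitrary: a rule: finite_psubset_induct)
  case (psubset R)
  have small: "sqrt (\<Sum>j\<in>B. (d j)\<^sup>2) \<le> sqrt (real S) * a" if "B \<subseteq> R" "card B \<le> S" for B
  proof -
    have "(\<Sum>j\<in>B. (d j)\<^sup>2) \<le> (\<Sum>j\<in>B. a\<^sup>2)"
      using that psubset.prems by (intro sum_mono) (metis abs_le_square_iff abs_of_nonneg subsetD)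
    also have "\<dots> \<le> real S * a\<^sup>2" using that by (simp add: mult_right_mono)
    finally have "sqrt (\<Sum>j\<in>B. (d j)\<^sup>2) \<le> sqrt (real S * a\<^sup>2)" by simp
    then show ?thesis using psubset.prems by (simp add: real_sqrt_mult)
  qed
  have sums: "0 \<le> (\<Sum>j\<in>R. \<bar>d j\<bar>) / sqrt (real S)" by (simp add: sum_nonneg)
  show ?case
  proof (cases "card R \<le> S")
    case True
    have "\<bar>F R\<bar> \<le> \<kappa> * sqrt (\<Sum>j\<in>R. (d j)\<^sup>2)" using psubset.prems True by blast
    also have "\<dots> \<le> \<kappa> * (sqrt (real S) * a + (\<Sum>j\<in>R. \<bar>d j\<bar>) / sqrt (real S))"
      using small[OF subset_refl True] sums by (intro mult_left_mono[OF _ \<kappa>]) linarith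
    finally show ?thesis .
  next
    case False
    then obtain B where B: "B \<subseteq> R" "card B = S" "\<And>i j. i \<in> B \<Longrightarrow> j \<in> R - B \<Longrightarrow> \<bar>d j\<bar> \<le> \<bar>d i\<bar>"
      using ex_largest_subset[OF psubset.hyps, of S "\<lambda>j. \<bar>d j\<bar>"] by auto
    \<comment> \<open>The mean of the removed block is the entry bound for the rest. Since
      \<open>sqrt S * a'\<close> is the l1 mass of \<open>B\<close> over \<open>sqrt S\<close>, it
      adds up with the mass of \<open>R - B\<close> to that of \<open>R\<close>.\<close>
    define a' where "a' = (\<Sum>j\<in>B. \<bar>d j\<bar>) / S"
    have "B \<noteq> {}" using B S by auto
    then have "R - B \<subset> R" using B by blast
    moreover have "a' \<ge> 0" by (simp add: a'_def sum_nonneg)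
    moreover have "\<bar>d j\<bar> \<le> a'" if "j \<in> R - B" for j
    proof -
      have "(\<Sum>i\<in>B. \<bar>d j\<bar>) \<le> (\<Sum>i\<in>B. \<bar>d i\<bar>)" using B(3) that by (intro sum_mono)
      then show ?thesis using B S by (simp add: a'_def pos_le_divide_eq mult.commute)
    qed
    ultimately have "\<bar>F (R - B)\<bar> \<le> \<kappa> * (sqrt (real S) * a' + (\<Sum>j\<in>R - B. \<bar>d j\<bar>) / sqrt (real S))"
    proof (rule psubset.IH)
      show "F (C \<union> D) = F C + F D" if "C \<inter> D = {}" "C \<union> D \<subseteq> R - B" for C D
        using that by (intro psubset.prems(3)) auto
      show "\<bar>F C\<bar> \<le> \<kappa> * sqrt (\<Sum>j\<in>C. (d j)\<^sup>2)" if "C \<subseteq> R - B" "card C \<le> S" for C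
        using that by (intro psubset.prems(4)) auto
    qed
    moreover have "sqrt (real S) * a' = (\<Sum>j\<in>B. \<bar>d j\<bar>) / sqrt (real S)"
      using S by (simp add: a'_def field_simps)
    moreover have "(\<Sum>j\<in>B. \<bar>d j\<bar>) + (\<Sum>j\<in>R - B. \<bar>d j\<bar>) = (\<Sum>j\<in>R. \<bar>d j\<bar>)"
      using sum.subset_diff[OF B(1) psubset.hyps, of "\<lambda>j. \<bar>d j\<bar>"] by simp
    ultimately have 1: "\<bar>F (R - B)\<bar> \<le> \<kappa> * ((\<Sum>j\<in>R. \<bar>d j\<bar>) / sqrt (real S))"
      by (metis add_divide_distrib)
    have "\<bar>F B\<bar> \<le> \<kappa> * sqrt (\<Sum>j\<in>B. (d j)\<^sup>2)" using psubset.prems(4) B by simp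
    also have "\<dots> \<le> \<kappa> * (sqrt (real S) * a)" using small B \<kappa> by (intro mult_left_mono) auto
    finally have 2: "\<bar>F B\<bar> \<le> \<kappa> * (sqrt (real S) * a)" .
    have "F R = F B + F (R - B)"
      using psubset.prems(3)[of B "R - B"] B by (simp add: Un_absorb1)
    then show ?thesis using 1 2 by (simp add: distrib_left)
  qed
qed

lemma sum_abs_le_sqrt_card:
  fixes d :: "'a \<Rightarrow> real"
  assumes "card T \<le> S"
  shows "(\<Sum>j\<in>T. \<bar>d j\<bar>) \<le> sqrt (real S) * sqrt (\<Sum>j\<in>T. (d j)\<^sup>2)"
proof -
  have "(\<Sum>j\<in>T. \<bar>d j\<bar>) \<le> sqrt (\<Sum>j\<in>T. (d j)\<^sup>2) * sqrt (real (card T))"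
    using L2_set_mult_ineq[of d "\<lambda>_. 1" T] by (simp add: L2_set_def)
  also have "\<dots> \<le> sqrt (\<Sum>j\<in>T. (d j)\<^sup>2) * sqrt (real S)"
    using assms by (intro mult_left_mono) (auto simp: sum_nonneg)
  finally show ?thesis by (simp add: mult.commute)
qed

text \<open>\<open>F T R\<close> stands for \<open>\<langle>V d\<^sub>T, V d\<^sub>R\<rangle> / n\<close>.\<close>

lemma cone_restricted_bound:
  fixes d :: "'a \<Rightarrow> real" and F :: "'a set \<Rightarrow> 'a set \<Rightarrow> real"
  defines "q \<equiv> \<lambda>T. sqrt (\<Sum>j\<in>T. (d j)\<^sup>2)"
  assumes U: "finite U" and T0: "T0 \<subseteq> U" "card T0 \<le> S" and S: "S \<ge> 1"
    and cone: "(\<Sum>j\<in>U - T0. \<bar>d j\<bar>) \<le> (\<Sum>j\<in>T0. \<bar>d j\<bar>)"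
    and \<theta>: "\<theta> \<ge> 0" "\<phi> - \<theta> > 0" and B: "B \<ge> 0"
    and add: "\<And>T R R'. R \<inter> R' = {} \<Longrightarrow> R \<union> R' \<subseteq> U \<Longrightarrow> F T (R \<union> R') = F T R + F T R'"
    and cross: "\<And>T R. T \<subseteq> U \<Longrightarrow> R \<subseteq> U \<Longrightarrow> T \<inter> R = {} \<Longrightarrow> card T \<le> 2 * S \<Longrightarrow> card R \<le> S \<Longrightarrow>
      \<bar>F T R\<bar> \<le> \<theta> * q T * q R"
    and lower: "\<And>T. T \<subseteq> U \<Longrightarrow> card T \<le> 2 * S \<Longrightarrow> \<phi> * (q T)\<^sup>2 \<le> F T T"
    and upper: "\<And>T. T \<subseteq> U \<Longrightarrow> F T U \<le> B * q T"
  shows "q U \<le> sqrt 2 * (B / (\<phi> - \<theta>))"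
proof -
  have q0: "q T \<ge> 0" for T by (simp add: q_def sum_nonneg)
  have q2: "(q T)\<^sup>2 = (\<Sum>j\<in>T. (d j)\<^sup>2)" for T by (simp add: q_def sum_nonneg)
  have fin: "finite (U - T0)" "finite T0" using U T0 finite_subset by auto
  \<comment> \<open>The minimum covers the case of fewer than \<open>S\<close> coordinates outside
    \<open>T0\<close>: then \<open>T1\<close> takes all of them and the tail \<open>R\<close> is
    empty.\<close>
  obtain T1 where T1: "T1 \<subseteq> U - T0" "card T1 = min S (card (U - T0))"
    "\<And>i j. i \<in> T1 \<Longrightarrow> j \<in> U - T0 - T1 \<Longrightarrow> \<bar>d j\<bar> \<le> \<bar>d i\<bar>"
    using ex_largest_subset[OF fin(1), of "min S (card (U - T0))" "\<lambda>j. \<bar>d j\<bar>"] by auto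
  define T where "T = T0 \<union> T1"
  define R where "R = U - T"
  have R_eq: "R = U - T0 - T1" by (auto simp: R_def T_def)
  have fin1: "finite T1" using T1 fin finite_subset by blast
  have T: "T \<subseteq> U" "card T \<le> 2 * S"
    using T0 T1 card_Un_le[of T0 T1] by (auto simp: T_def)
  define s where "s = (\<Sum>j\<in>U - T0. \<bar>d j\<bar>)"
  have s0: "s \<ge> 0" by (simp add: s_def sum_nonneg)
  \<comment> \<open>The divisor \<open>S\<close> differs from the size of \<open>T1\<close> only if
    the tail is empty, and then the bound by \<open>a\<close> is vacuous.\<close>
  define a where "a = (\<Sum>j\<in>T1. \<bar>d j\<bar>) / S"
  have a0: "a \<ge> 0" by (simp add: a_def sum_nonneg)
  have a: "\<bar>d j\<bar> \<le> a" if "j \<in> R" for j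
  proof -
    have "T1 \<noteq> U - T0" using that by (auto simp: R_eq)
    then have "card T1 \<noteq> card (U - T0)" using card_subset_eq[OF fin(1) T1(1)] by blast
    then have "card T1 = S" using T1(2) by (auto simp: min_def split: if_splits)
    moreover have "(\<Sum>i\<in>T1. \<bar>d j\<bar>) \<le> (\<Sum>i\<in>T1. \<bar>d i\<bar>)"
      using T1(3) that by (intro sum_mono) (auto simp: R_eq)
    ultimately show ?thesis using S by (simp add: a_def pos_le_divide_eq mult.commute)
  qed
  have s_split: "s = (\<Sum>j\<in>T1. \<bar>d j\<bar>) + (\<Sum>j\<in>R. \<bar>d j\<bar>)"
    using sum.subset_diff[OF T1(1) fin(1), of "\<lambda>j. \<bar>d j\<bar>"] by (simp add: s_def R_eq)
  have "q T0 \<le> q T"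
    unfolding q_def using fin fin1 by (intro real_sqrt_le_mono sum_mono2) (auto simp: T_def)
  then have "sqrt (real S) * q T0 \<le> sqrt (real S) * q T" by (rule mult_left_mono) simp
  moreover have "s \<le> sqrt (real S) * q T0"
    using cone sum_abs_le_sqrt_card[OF T0(2), of d] by (simp add: s_def q_def)
  ultimately have "s \<le> sqrt (real S) * q T" by simp
  then have s_le: "s / sqrt (real S) \<le> q T" using S by (simp add: pos_divide_le_eq mult.commute)
  \<comment> \<open>Restricted orthogonality bounds the correlation of the head \<open>T\<close>
    with each tail block by \<open>\<theta> * q T\<close> times the norm of the block. The mass of
    \<open>T1\<close> pays for the first tail block, so the total is governed by \<open>s\<close>,
    which the cone condition bounds.\<close>
  have "\<bar>F T R\<bar> \<le> (\<theta> * q T) * (sqrt (real S) * a + (\<Sum>j\<in>R. \<bar>d j\<bar>) / sqrt (real S))"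
  proof (rule additive_block_bound)
    show "finite R" using U by (simp add: R_def)
    show "\<bar>F T B\<bar> \<le> \<theta> * q T * sqrt (\<Sum>j\<in>B. (d j)\<^sup>2)" if "B \<subseteq> R" "card B \<le> S" for B
      using that T cross[of T B] by (auto simp: R_def q_def)
    show "F T (B \<union> C) = F T B + F T C" if "B \<inter> C = {}" "B \<union> C \<subseteq> R" for B C
      using that by (intro add) (auto simp: R_def)
  qed (use S \<theta> q0 a0 a in auto)
  also have "sqrt (real S) * a = (\<Sum>j\<in>T1. \<bar>d j\<bar>) / sqrt (real S)"
    using S by (simp add: a_def field_simps)
  also have "\<dots> + (\<Sum>j\<in>R. \<bar>d j\<bar>) / sqrt (real S) = s / sqrt (real S)"
    by (simp add: s_split add_divide_distrib)
  also have "\<theta> * q T * (s / sqrt (real S)) \<le> \<theta> * q T * q T"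
    using s_le \<theta> q0 by (intro mult_left_mono) auto
  finally have "\<bar>F T R\<bar> \<le> \<theta> * (q T)\<^sup>2" by (simp add: power2_eq_square)
  moreover have "F T U = F T T + F T R"
    using add[of T R T] T by (simp add: R_def Un_absorb1)
  \<comment> \<open>Splitting into head and tail bounds \<open>F T U\<close> from below by
    \<open>(\<phi> - \<theta>) * (q T)\<^sup>2\<close>; the correlation hypothesis bounds it from
    above.\<close>
  ultimately have "(\<phi> - \<theta>) * (q T)\<^sup>2 \<le> B * q T"
    using lower[OF T] upper[OF T(1)] by (simp add: left_diff_distrib)
  then have "(\<phi> - \<theta>) * q T \<le> B"
    using q0[of T] B by (cases "q T = 0") (auto simp: power2_eq_square less_eq_real_def)
  then have qT: "q T \<le> B / (\<phi> - \<theta>)" using \<theta> by (simp add: pos_le_divide_eq mult.commute)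
  \<comment> \<open>Tail entries are at most \<open>a\<close>, and both \<open>S * a\<close> and the
    tail mass are at most \<open>s\<close>. So the tail norm is at most \<open>s / sqrt S\<close>,
    hence at most \<open>q T\<close>; equal bounds for head and tail produce the factor
    \<open>sqrt 2\<close>.\<close>
  have "(q R)\<^sup>2 \<le> (\<Sum>j\<in>R. a * \<bar>d j\<bar>)"
    unfolding q2 by (intro sum_mono) (metis a abs_ge_zero mult_right_mono power2_abs power2_eq_square)
  also have "\<dots> = a * (\<Sum>j\<in>R. \<bar>d j\<bar>)" by (simp add: sum_distrib_left)
  also have "\<dots> \<le> (s / S) * s"
    using s_split by (intro mult_mono) (auto simp: a_def sum_nonneg s0 divide_right_mono)
  also have "\<dots> = (s / sqrt (real S))\<^sup>2" by (simp add: power_divide power2_eq_square)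
  also have "\<dots> \<le> (q T)\<^sup>2" using s_le s0 by (intro power_mono) auto
  finally have "(q R)\<^sup>2 \<le> (q T)\<^sup>2" .
  moreover have "(q U)\<^sup>2 = (q T)\<^sup>2 + (q R)\<^sup>2"
    unfolding q2 R_def using sum.subset_diff[OF T(1) U, of "\<lambda>j. (d j)\<^sup>2"] by simp
  ultimately have "(q U)\<^sup>2 \<le> (sqrt 2 * q T)\<^sup>2" by (simp add: power_mult_distrib)
  then have "q U \<le> sqrt 2 * q T" by (rule power2_le_imp_le) (simp add: q0)
  also have "\<dots> \<le> sqrt 2 * (B / (\<phi> - \<theta>))" using qT by (rule mult_left_mono) simp
  finally show ?thesis .
qed

subsection \<open>Square-integrable functions\<close>

lemma L2D:
  assumes "f \<in> L2"
  shows "f \<in> borel_measurable (lebesgue_on unit_square)"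
    "integrable (lebesgue_on unit_square) (\<lambda>z. (f z)\<^sup>2)"
  using assms by (auto simp: L2_def)

lemma integrable_mult_L2:
  assumes "f \<in> L2" "g \<in> L2"
  shows "integrable (lebesgue_on unit_square) (\<lambda>z. f z * g z)"
proof (rule Bochner_Integration.integrable_bound)
  show "integrable (lebesgue_on unit_square) (\<lambda>z. (f z)\<^sup>2 + (g z)\<^sup>2)"
    using assms by (intro Bochner_Integration.integrable_add L2D)
  show "(\<lambda>z. f z * g z) \<in> borel_measurable (lebesgue_on unit_square)"
    using assms[THEN L2D(1)] by measurable
  have "\<bar>a * b\<bar> \<le> \<bar>a\<^sup>2 + b\<^sup>2\<bar>" for a b :: real
    using sum_squares_bound[of a b] sum_squares_bound[of a "-b"] sum_power2_ge_zero[of a b]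
    by (intro abs_leI) (simp_all add: abs_of_nonneg)
  then show "AE z in lebesgue_on unit_square. norm (f z * g z) \<le> norm ((f z)\<^sup>2 + (g z)\<^sup>2)"
    by simp
qed

lemma L2_add:
  assumes "f \<in> L2" "g \<in> L2"
  shows "(\<lambda>z. f z + g z) \<in> L2"
proof -
  have "integrable (lebesgue_on unit_square) (\<lambda>z. (f z)\<^sup>2 + (g z)\<^sup>2 + 2 * (f z * g z))"
    using assms by (intro Bochner_Integration.integrable_add integrable_mult_right integrable_mult_L2 L2D)
  then have "integrable (lebesgue_on unit_square) (\<lambda>z. (f z + g z)\<^sup>2)"
    by (simp add: power2_sum mult.assoc)
  then show ?thesis using assms[THEN L2D(1)] by (auto simp: L2_def)
qed

lemma L2_cmult:
  assumes "f \<in> L2"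
  shows "(\<lambda>z. c * f z) \<in> L2"
  using L2D[OF assms] by (auto simp: L2_def power_mult_distrib)

lemma L2_diff:
  assumes "f \<in> L2" "g \<in> L2"
  shows "(\<lambda>z. f z - g z) \<in> L2"
  using L2_add[OF assms(1) L2_cmult[OF assms(2), of "-1"]] by simp

lemma L2_sum:
  assumes "\<And>j. j \<in> J \<Longrightarrow> f j \<in> L2"
  shows "(\<lambda>z. \<Sum>j\<in>J. f j z) \<in> L2"
  using assms
proof (induction J rule: infinite_finite_induct)
  case (insert j J)
  then show ?case by (simp add: L2_add)
qed (auto simp: L2_def)

lemma lincomb_fun_L2:
  assumes "\<And>j. j < p \<Longrightarrow> b j \<in> L2" "\<eta> \<in> carrier_vec p"
  shows "lincomb_fun b \<eta> \<in> L2"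
proof -
  have "lincomb_fun b \<eta> = (\<lambda>z. \<Sum>j<p. \<eta> $ j * b j z)"
    using assms(2) by (auto simp: lincomb_fun_def)
  then show ?thesis using assms(1) by (auto intro!: L2_sum L2_cmult)
qed

lemma norm_L2_nonneg [simp]: "norm_L2 f \<ge> 0"
  by (simp add: norm_L2_def)

lemma norm_L2_square: "(norm_L2 f)\<^sup>2 = inner_L2 f f"
  by (simp add: norm_L2_def inner_L2_def power2_eq_square)

section \<open>Inner product and norm inequalities for square-integrable functions\<close>

lemma inner_L2_add_right:
  assumes "f \<in> L2" "g \<in> L2" "h \<in> L2"
  shows "inner_L2 f (\<lambda>z. g z + h z) = inner_L2 f g + inner_L2 f h"
  using assms by (simp add: inner_L2_def distrib_left integrable_mult_L2)

lemma inner_L2_cmult_right: "inner_L2 f (\<lambda>z. c * g z) = c * inner_L2 f g"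
proof -
  have "inner_L2 f (\<lambda>z. c * g z) = (\<integral>z. c * (f z * g z) \<partial>(lebesgue_on unit_square))"
    unfolding inner_L2_def by (intro Bochner_Integration.integral_cong) auto
  then show ?thesis by (simp add: inner_L2_def)
qed

lemma inner_L2_diff_right:
  assumes "f \<in> L2" "g \<in> L2" "h \<in> L2"
  shows "inner_L2 f (\<lambda>z. g z - h z) = inner_L2 f g - inner_L2 f h"
  using assms by (simp add: inner_L2_def right_diff_distrib integrable_mult_L2)

lemma inner_L2_commute: "inner_L2 f g = inner_L2 g f"
  by (simp add: inner_L2_def mult.commute)

lemma inner_L2_sum_right:
  assumes "f \<in> L2" "\<And>j. j \<in> J \<Longrightarrow> g j \<in> L2"
  shows "inner_L2 f (\<lambda>z. \<Sum>j\<in>J. g j z) = (\<Sum>j\<in>J. inner_L2 f (g j))"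
  using assms by (simp add: inner_L2_def sum_distrib_left integrable_mult_L2)

lemma inner_L2_lincomb_fun:
  assumes "f \<in> L2" "\<And>j. j < p \<Longrightarrow> b j \<in> L2" "\<eta> \<in> carrier_vec p"
  shows "inner_L2 f (lincomb_fun b \<eta>) = (\<Sum>j<p. inner_L2 f (b j) * \<eta> $ j)"
proof -
  have "lincomb_fun b \<eta> = (\<lambda>z. \<Sum>j<p. \<eta> $ j * b j z)"
    using assms(3) by (auto simp: lincomb_fun_def)
  then show ?thesis
    using inner_L2_sum_right[OF assms(1), of "{..<p}" "\<lambda>j z. \<eta> $ j * b j z"] assms(2)
    by (simp add: L2_cmult inner_L2_cmult_right) (simp add: mult.commute)
qed

text \<open>Discriminant argument for the squared norm of \<open>f - k * g\<close> as a polynomial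
  in \<open>k\<close>. Functions are not identified modulo null sets, so a vanishing norm does not
  make \<open>g\<close> zero; the case \<open>c = 0\<close> is settled by the polynomial
  itself.\<close>

lemma abs_inner_L2_le:
  assumes "f \<in> L2" "g \<in> L2"
  shows "\<bar>inner_L2 f g\<bar> \<le> norm_L2 f * norm_L2 g"
proof -
  define a b c where "a = (norm_L2 f)\<^sup>2" and "b = inner_L2 f g" and "c = (norm_L2 g)\<^sup>2"
  have quad: "0 \<le> a - 2 * k * b + k\<^sup>2 * c" for k
  proof -
    let ?h = "\<lambda>z. f z - k * g z"
    have "0 \<le> inner_L2 ?h ?h" by (simp add: norm_L2_square[symmetric])
    also have "inner_L2 ?h ?h = inner_L2 ?h f - k * inner_L2 ?h g"
      using assms by (subst inner_L2_diff_right) (auto simp: L2_diff L2_cmult inner_L2_cmult_right)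
    also have "\<dots> = a - 2 * k * b + k\<^sup>2 * c"
      using assms unfolding inner_L2_commute[of ?h]
      by (simp add: inner_L2_diff_right L2_cmult inner_L2_cmult_right inner_L2_commute[of g f]
          a_def b_def c_def norm_L2_square algebra_simps) (simp add: power2_eq_square)
    finally show ?thesis .
  qed
  have "b\<^sup>2 \<le> a * c"
  proof (cases "c = 0")
    case True
    have "b = 0"
    proof (rule ccontr)
      assume "b \<noteq> 0"
      \<comment> \<open>With \<open>c = 0\<close> the polynomial takes the value -1 at this
        \<open>k\<close>.\<close>
      then show False using quad[of "(a + 1) / (2 * b)"] True by simp
    qed
    then show ?thesis using True by simp
  next
    case False
    then have "c > 0" by (auto simp: c_def)
    \<comment> \<open>The quotient \<open>b / c\<close> is the minimiser of the polynomial.\<close>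
    then show ?thesis using quad[of "b / c"] by (simp add: field_simps power2_eq_square)
  qed
  then have "sqrt (b\<^sup>2) \<le> sqrt (a * c)" by (rule real_sqrt_le_mono)
  then show ?thesis by (simp add: a_def b_def c_def real_sqrt_mult)
qed

lemma norm_L2_triangle:
  assumes "f \<in> L2" "g \<in> L2"
  shows "norm_L2 (\<lambda>z. f z + g z) \<le> norm_L2 f + norm_L2 g"
proof (rule power2_le_imp_le)
  let ?h = "\<lambda>z. f z + g z"
  have "(norm_L2 ?h)\<^sup>2 = inner_L2 ?h f + inner_L2 ?h g"
    using assms unfolding norm_L2_square by (subst inner_L2_add_right) (auto simp: L2_add)
  also have "\<dots> = (norm_L2 f)\<^sup>2 + (norm_L2 g)\<^sup>2 + 2 * inner_L2 f g"
    using assms unfolding inner_L2_commute[of ?h]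
    by (simp add: inner_L2_add_right inner_L2_commute[of g f] norm_L2_square)
  also have "\<dots> \<le> (norm_L2 f + norm_L2 g)\<^sup>2"
    using abs_inner_L2_le[OF assms] by (simp add: power2_sum)
  finally show "(norm_L2 ?h)\<^sup>2 \<le> (norm_L2 f + norm_L2 g)\<^sup>2" .
qed simp

lemma norm_L2_minus_commute: "norm_L2 (\<lambda>z. f z - g z) = norm_L2 (\<lambda>z. g z - f z)"
  unfolding norm_L2_def by (subst power2_commute) (rule refl)

lemma norm_L2_sum_le:
  assumes "\<And>j. j \<in> J \<Longrightarrow> f j \<in> L2"
  shows "norm_L2 (\<lambda>z. \<Sum>j\<in>J. f j z) \<le> (\<Sum>j\<in>J. norm_L2 (f j))"
  using assms
proof (induction J rule: infinite_finite_induct)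
  case (insert j J)
  then have "norm_L2 (\<lambda>z. f j z + (\<Sum>j\<in>J. f j z)) \<le> norm_L2 (f j) + norm_L2 (\<lambda>z. \<Sum>j\<in>J. f j z)"
    by (intro norm_L2_triangle L2_sum) auto
  then show ?case using insert by simp
qed (auto simp: norm_L2_def)

text \<open>Triangle inequality over the basis, then Cauchy--Schwarz between basis norms and
  coefficients. The factor is the constant \<open>C_b\<close> of the final bound.\<close>

lemma norm_L2_lincomb_fun_le:
  assumes "\<And>j. j < p \<Longrightarrow> b j \<in> L2" "\<eta> \<in> carrier_vec p"
  shows "norm_L2 (lincomb_fun b \<eta>)
    \<le> sqrt (\<Sum>j<p. \<integral>z. (b j z)\<^sup>2 \<partial>(lebesgue_on unit_square)) * l2_norm \<eta>"
proof -
  have "lincomb_fun b \<eta> = (\<lambda>z. \<Sum>j<p. \<eta> $ j * b j z)"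
    using assms(2) by (auto simp: lincomb_fun_def)
  then have "norm_L2 (lincomb_fun b \<eta>) \<le> (\<Sum>j<p. norm_L2 (\<lambda>z. \<eta> $ j * b j z))"
    using assms(1) by (auto intro!: norm_L2_sum_le L2_cmult)
  also have "\<dots> = (\<Sum>j<p. \<bar>norm_L2 (b j)\<bar> * \<bar>\<eta> $ j\<bar>)"
    by (simp add: norm_L2_def power_mult_distrib real_sqrt_mult mult.commute)
  also have "\<dots> \<le> L2_set (\<lambda>j. norm_L2 (b j)) {..<p} * L2_set (\<lambda>j. \<eta> $ j) {..<p}"
    by (rule L2_set_mult_ineq)
  also have "\<dots> = sqrt (\<Sum>j<p. \<integral>z. (b j z)\<^sup>2 \<partial>(lebesgue_on unit_square)) * l2_norm \<eta>"
    using assms(2) by (simp add: L2_set_def norm_L2_def l2_norm_def)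
  finally show ?thesis .
qed

subsection \<open>Gaussian noise\<close>

text \<open>For \<open>x\<close> and \<open>t\<close> of equal sign, \<open>(t + x)\<^sup>2\<close>
  is at least \<open>t\<^sup>2 + x\<^sup>2\<close>, so the exponential splits off the factor in
  \<open>t\<close>.\<close>

lemma normal_density_add_le:
  assumes "s > 0" "0 \<le> x * t"
  shows "normal_density 0 s (t + x) \<le> exp (- (t / s)\<^sup>2 / 2) * normal_density 0 s x"
proof -
  have "(t / s)\<^sup>2 / 2 + x\<^sup>2 / (2 * s\<^sup>2) \<le> (t + x)\<^sup>2 / (2 * s\<^sup>2)"
  proof -
    have "(t\<^sup>2 + x\<^sup>2) / (2 * s\<^sup>2) \<le> (t + x)\<^sup>2 / (2 * s\<^sup>2)"
      using assms by (intro divide_right_mono) (auto simp: power2_sum mult.commute)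
    then show ?thesis by (simp add: power_divide add_divide_distrib)
  qed
  then have "exp (- (t + x)\<^sup>2 / (2 * s\<^sup>2)) \<le> exp (- (t / s)\<^sup>2 / 2) * exp (- x\<^sup>2 / (2 * s\<^sup>2))"
    by (simp add: exp_add[symmetric])
  then show ?thesis
    using assms(1) by (simp add: normal_density_def divide_right_mono mult.left_commute)
qed

text \<open>Translation by \<open>t\<close>, then the pointwise density comparison. The condition on
  \<open>A\<close> makes the signs agree; it admits the right tail with shift \<open>t\<close> and
  the left tail with shift \<open>-t\<close>.\<close>

lemma nn_integral_normal_tail_le:
  assumes s: "s > 0" and A: "A \<in> sets borel" and t: "\<And>x. t + x \<in> A \<Longrightarrow> 0 \<le> x * t"
  shows "(\<integral>\<^sup>+x. ennreal (normal_density 0 s x) * indicator A x \<partial>lborel)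
    \<le> ennreal (exp (- (t / s)\<^sup>2 / 2)) * (\<integral>\<^sup>+x. ennreal (normal_density 0 s x) * indicator A (t + x) \<partial>lborel)"
proof -
  note [measurable] = A
  have "(\<integral>\<^sup>+x. ennreal (normal_density 0 s x) * indicator A x \<partial>lborel)
     = (\<integral>\<^sup>+x. ennreal (normal_density 0 s (t + x)) * indicator A (t + x) \<partial>lborel)"
    by (subst nn_integral_real_affine[where c = 1 and t = t]) auto
  also have "\<dots> \<le> (\<integral>\<^sup>+x. ennreal (exp (- (t / s)\<^sup>2 / 2)) * (ennreal (normal_density 0 s x) * indicator A (t + x)) \<partial>lborel)"
  proof (rule nn_integral_mono)
    fix x
    show "ennreal (normal_density 0 s (t + x)) * indicator A (t + x)
      \<le> ennreal (exp (- (t / s)\<^sup>2 / 2)) * (ennreal (normal_density 0 s x) * indicator A (t + x))"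
      using normal_density_add_le[OF s t, of x]
      by (auto simp: indicator_def ennreal_mult[symmetric] intro!: ennreal_leI)
  qed
  also have "\<dots> = ennreal (exp (- (t / s)\<^sup>2 / 2)) * (\<integral>\<^sup>+x. ennreal (normal_density 0 s x) * indicator A (t + x) \<partial>lborel)"
    by (rule nn_integral_cmult) measurable
  finally show ?thesis .
qed

text \<open>Comparing each tail with a full half-line saves the factor 2 of the naive two-sided bound.\<close>

lemma (in prob_space) normal_two_sided_tail:
  assumes Z: "distributed M lborel Z (normal_density 0 s)" and s: "s > 0" and t: "t \<ge> 0"
  shows "prob {\<omega> \<in> space M. \<bar>Z \<omega>\<bar> > t} \<le> exp (- (t / s)\<^sup>2 / 2)"
proof -
  let ?\<phi> = "\<lambda>x. ennreal (normal_density 0 s x)"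
  let ?e = "exp (- (t / s)\<^sup>2 / 2)"
  have [measurable]: "(\<lambda>x. ennreal (normal_density 0 s x)) \<in> borel_measurable lborel" by measurable
  have "{\<omega> \<in> space M. \<bar>Z \<omega>\<bar> > t} = Z -` ({t<..} \<union> {..<-t}) \<inter> space M" by auto
  then have "emeasure M {\<omega> \<in> space M. \<bar>Z \<omega>\<bar> > t} = (\<integral>\<^sup>+x. ?\<phi> x * indicator ({t<..} \<union> {..<-t}) x \<partial>lborel)"
    using distributed_emeasure[OF Z, of "{t<..} \<union> {..<-t}"] by simp
  also have "\<dots> = (\<integral>\<^sup>+x. ?\<phi> x * indicator {t<..} x + ?\<phi> x * indicator {..<-t} x \<partial>lborel)"
    using t by (intro nn_integral_cong) (auto simp: indicator_def)
  also have "\<dots> = (\<integral>\<^sup>+x. ?\<phi> x * indicator {t<..} x \<partial>lborel) + (\<integral>\<^sup>+x. ?\<phi> x * indicator {..<-t} x \<partial>lborel)"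
    by (rule nn_integral_add) measurable
  also have "\<dots> \<le> ennreal ?e * (\<integral>\<^sup>+x. ?\<phi> x * indicator {t<..} (t + x) \<partial>lborel)
      + ennreal ?e * (\<integral>\<^sup>+x. ?\<phi> x * indicator {..<-t} (-t + x) \<partial>lborel)"
    using nn_integral_normal_tail_le[OF s, of "{t<..}" t] nn_integral_normal_tail_le[OF s, of "{..<-t}" "-t"] t
    by (intro add_mono) (auto simp: mult_nonpos_nonneg)
  also have "\<dots> = ennreal ?e * (\<integral>\<^sup>+x. ?\<phi> x * indicator {t<..} (t + x) + ?\<phi> x * indicator {..<-t} (-t + x) \<partial>lborel)"
    by (subst nn_integral_add) (auto simp: distrib_left)
  \<comment> \<open>After the shifts the indicators are those of \<open>x > 0\<close> and
    \<open>x < 0\<close>; these are disjoint, so together they cost at most the total mass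
    1.\<close>
  also have "\<dots> \<le> ennreal ?e * (\<integral>\<^sup>+x. ?\<phi> x \<partial>lborel)"
    by (intro mult_left_mono nn_integral_mono) (auto simp: indicator_def)
  also have "(\<integral>\<^sup>+x. ?\<phi> x \<partial>lborel) = 1"
    using s by (subst nn_integral_eq_integral) auto
  finally show ?thesis by (simp add: emeasure_eq_measure)
qed

text \<open>A summand with weight zero has no density. The sum is therefore taken over the nonzero
  weights, where independence and scaling of normal variables apply, and is then extended by
  zeros.\<close>

lemma (in prob_space) weighted_sum_indep_normal:
  fixes a :: "'i \<Rightarrow> real"
  assumes "finite I" and indep: "indep_vars (\<lambda>_. borel) \<epsilon> I"
    and normal: "\<And>i. i \<in> I \<Longrightarrow> distributed M lborel (\<epsilon> i) (normal_density 0 \<sigma>)"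
    and \<sigma>: "\<sigma> > 0" and nz: "\<exists>i\<in>I. a i \<noteq> 0"
  shows "distributed M lborel (\<lambda>\<omega>. \<Sum>i\<in>I. a i * \<epsilon> i \<omega>) (normal_density 0 (\<sigma> * sqrt (\<Sum>i\<in>I. (a i)\<^sup>2)))"
proof -
  define J where "J = {i \<in> I. a i \<noteq> 0}"
  have J: "finite J" "J \<noteq> {}" "J \<subseteq> I" using assms(1) nz by (auto simp: J_def)
  have "indep_vars (\<lambda>_. borel) (\<lambda>i \<omega>. a i * \<epsilon> i \<omega>) J"
    using indep_vars_subset[OF indep J(3)] by (rule indep_vars_compose2) measurable
  moreover have "distributed M lborel (\<lambda>\<omega>. a i * \<epsilon> i \<omega>) (normal_density 0 (\<bar>a i\<bar> * \<sigma>))" if "i \<in> J" for i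
    using normal_density_affine[OF normal \<sigma>, of i "a i" 0] that by (simp add: J_def)
  ultimately have "distributed M lborel (\<lambda>\<omega>. \<Sum>i\<in>J. a i * \<epsilon> i \<omega>)
     (normal_density (\<Sum>i\<in>J. 0) (sqrt (\<Sum>i\<in>J. (\<bar>a i\<bar> * \<sigma>)\<^sup>2)))"
    using J \<sigma> by (intro sum_indep_normal) (auto simp: J_def)
  moreover have "(\<Sum>i\<in>J. a i * \<epsilon> i \<omega>) = (\<Sum>i\<in>I. a i * \<epsilon> i \<omega>)" for \<omega>
    using assms(1) by (intro sum.mono_neutral_left) (auto simp: J_def)
  moreover have "(\<Sum>i\<in>J. (\<bar>a i\<bar> * \<sigma>)\<^sup>2) = (\<Sum>i\<in>I. (a i)\<^sup>2 * \<sigma>\<^sup>2)"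
    using assms(1) by (intro sum.mono_neutral_cong_left) (auto simp: J_def power_mult_distrib)
  moreover have "sqrt (\<Sum>i\<in>I. (a i)\<^sup>2 * \<sigma>\<^sup>2) = \<sigma> * sqrt (\<Sum>i\<in>I. (a i)\<^sup>2)"
    using \<sigma> by (simp only: sum_distrib_right[symmetric] real_sqrt_mult) simp
  ultimately show ?thesis by simp
qed

text \<open>Union bound. The threshold is \<open>C * sqrt (ln (card J))\<close> standard deviations,
  so each tail is at most \<open>card J\<close> to the power \<open>- C\<^sup>2 / 2\<close>, and
  summing over \<open>J\<close> raises the exponent by 1.\<close>

lemma (in prob_space) normal_noise_uniform_bound:
  fixes a :: "'j \<Rightarrow> 'i \<Rightarrow> real"
  assumes I: "finite I" and indep: "indep_vars (\<lambda>_. borel) \<epsilon> I"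
    and normal: "\<And>i. i \<in> I \<Longrightarrow> distributed M lborel (\<epsilon> i) (normal_density 0 \<sigma>)"
    and \<sigma>: "\<sigma> > 0"
    and J: "finite J" "J \<noteq> {}"
    and a: "\<And>j. j \<in> J \<Longrightarrow> (\<Sum>i\<in>I. (a j i)\<^sup>2) > 0"
    and C: "C \<ge> 0"
  defines "E \<equiv> {\<omega> \<in> space M. \<forall>j\<in>J. \<bar>\<Sum>i\<in>I. a j i * \<epsilon> i \<omega>\<bar> \<le> C * sqrt (ln (card J)) * (\<sigma> * sqrt (\<Sum>i\<in>I. (a j i)\<^sup>2))}"
  shows "E \<in> events" "prob E \<ge> 1 - real (card J) powr (1 - C\<^sup>2 / 2)"
proof -
  define t where "t j = C * sqrt (ln (card J)) * (\<sigma> * sqrt (\<Sum>i\<in>I. (a j i)\<^sup>2))" for j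
  define D where "D j = {\<omega> \<in> space M. \<bar>\<Sum>i\<in>I. a j i * \<epsilon> i \<omega>\<bar> > t j}" for j
  have cJ: "card J \<ge> 1" using J by (simp add: Suc_le_eq card_gt_0_iff)
  have meas[measurable]: "random_variable borel (\<lambda>\<omega>. \<Sum>i\<in>I. a j i * \<epsilon> i \<omega>)" for j
    using indep by (intro borel_measurable_sum borel_measurable_times) (auto simp: indep_vars_def)
  have D[measurable]: "D j \<in> events" for j unfolding D_def by measurable
  have E_eq: "E = space M - (\<Union>j\<in>J. D j)"
    by (auto simp: E_def D_def t_def not_less)
  show "E \<in> events" unfolding E_eq using J(1) D by (intro sets.compl_sets sets.finite_UN) auto
  have "prob (D j) \<le> real (card J) powr (- (C\<^sup>2 / 2))" if j: "j \<in> J" for j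
  proof -
    have "\<exists>i\<in>I. a j i \<noteq> 0"
    proof (rule ccontr)
      assume "\<not> ?thesis"
      then have "(\<Sum>i\<in>I. (a j i)\<^sup>2) = 0" by (intro sum.neutral) auto
      then show False using a[OF j] by simp
    qed
    from weighted_sum_indep_normal[OF I indep normal \<sigma> this]
    have "prob (D j) \<le> exp (- (t j / (\<sigma> * sqrt (\<Sum>i\<in>I. (a j i)\<^sup>2)))\<^sup>2 / 2)"
      unfolding D_def using \<sigma> a[OF j] C cJ by (intro normal_two_sided_tail) (auto simp: t_def)
    also have "t j / (\<sigma> * sqrt (\<Sum>i\<in>I. (a j i)\<^sup>2)) = C * sqrt (ln (card J))"
      using \<sigma> a[OF j] by (simp add: t_def)
    also have "exp (- (C * sqrt (ln (card J)))\<^sup>2 / 2) = real (card J) powr (- (C\<^sup>2 / 2))"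
      using cJ J by (simp add: powr_def power_mult_distrib)
    finally show ?thesis .
  qed
  then have "(\<Sum>j\<in>J. prob (D j)) \<le> (\<Sum>j\<in>J. real (card J) powr (- (C\<^sup>2 / 2)))" by (rule sum_mono)
  also have "\<dots> = real (card J) powr 1 * real (card J) powr (- (C\<^sup>2 / 2))"
    using cJ by simp
  also have "\<dots> = real (card J) powr (1 - C\<^sup>2 / 2)"
    by (simp only: powr_add[symmetric]) simp
  finally have "prob (\<Union>j\<in>J. D j) \<le> real (card J) powr (1 - C\<^sup>2 / 2)"
    using finite_measure_subadditive_finite[OF J(1), of D] by (auto simp: image_subset_iff)
  then show "prob E \<ge> 1 - real (card J) powr (1 - C\<^sup>2 / 2)"
    unfolding E_eq using J(1) D by (subst prob_compl) auto
qed

subsection \<open>The Dantzig selector\<close>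

lemma emp_norm_eq_l2_norm:
  assumes "u \<in> carrier_vec n"
  shows "emp_norm u = l2_norm u / sqrt (real n)"
  using assms by (simp add: emp_norm_def l2_norm_def real_sqrt_divide)

lemma l2_norm_eq_L2_set:
  assumes "u \<in> carrier_vec n"
  shows "l2_norm u = L2_set (\<lambda>i. u $ i) {..<n}"
  using assms by (simp add: l2_norm_def L2_set_def)

lemma l2_norm_triangle:
  assumes "u \<in> carrier_vec n" "v \<in> carrier_vec n"
  shows "l2_norm (u + v) \<le> l2_norm u + l2_norm v"
proof -
  have "l2_norm (u + v) = L2_set (\<lambda>i. u $ i + v $ i) {..<n}"
    using assms by (simp add: l2_norm_def L2_set_def)
  also have "\<dots> \<le> l2_norm u + l2_norm v"
    using assms by (simp add: l2_norm_eq_L2_set L2_set_triangle_ineq)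
  finally show ?thesis .
qed

lemma l2_norm_le_of_entries:
  assumes "u \<in> carrier_vec n" "\<And>i. i < n \<Longrightarrow> \<bar>u $ i\<bar> \<le> K" "K \<ge> 0"
  shows "l2_norm u \<le> sqrt (real n) * K"
proof -
  have "(\<Sum>i<n. (u $ i)\<^sup>2) \<le> (\<Sum>i<n. K\<^sup>2)"
    using assms(2,3) by (intro sum_mono) (metis abs_le_square_iff abs_of_nonneg lessThan_iff)
  then have "l2_norm u \<le> sqrt (real n * K\<^sup>2)"
    using assms(1) by (simp add: l2_norm_def)
  then show ?thesis using assms(3) by (simp add: real_sqrt_mult)
qed

text \<open>Off \<open>T\<close> the error is \<open>c\<close> itself. Since \<open>c\<close> has no
  more l1 mass than \<open>a\<close>, its mass off \<open>T\<close> must be offset by a loss on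
  \<open>T\<close>, and that loss is at most the error on \<open>T\<close>.\<close>

lemma sum_abs_cone:
  fixes a c :: "'a \<Rightarrow> real"
  assumes "finite U" and T: "T \<subseteq> U" and "\<And>j. j \<in> U - T \<Longrightarrow> a j = 0"
    and le: "(\<Sum>j\<in>U. \<bar>c j\<bar>) \<le> (\<Sum>j\<in>U. \<bar>a j\<bar>)"
  shows "(\<Sum>j\<in>U - T. \<bar>c j - a j\<bar>) \<le> (\<Sum>j\<in>T. \<bar>c j - a j\<bar>)"
proof -
  have split: "(\<Sum>j\<in>U. g j) = (\<Sum>j\<in>U - T. g j) + (\<Sum>j\<in>T. g j)" for g :: "'a \<Rightarrow> real"
    using sum.subset_diff[OF T assms(1)] .
  have "(\<Sum>j\<in>U - T. \<bar>a j\<bar>) = 0" using assms(3) by (intro sum.neutral) auto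
  moreover have "(\<Sum>j\<in>U - T. \<bar>c j - a j\<bar>) = (\<Sum>j\<in>U - T. \<bar>c j\<bar>)"
    using assms(3) by (intro sum.cong) auto
  moreover have "(\<Sum>j\<in>T. \<bar>a j\<bar>) \<le> (\<Sum>j\<in>T. \<bar>c j\<bar> + \<bar>c j - a j\<bar>)"
    by (intro sum_mono) linarith
  ultimately show ?thesis
    using le split[of "\<lambda>j. \<bar>c j\<bar>"] split[of "\<lambda>j. \<bar>a j\<bar>"] by (simp add: sum.distrib)
qed

lemma linf_norm_le_iff: "linf_norm v \<le> K \<longleftrightarrow> 0 \<le> K \<and> (\<forall>i<dim_vec v. \<bar>v $ i\<bar> \<le> K)"
  by (auto simp: linf_norm_def)

text \<open>The diagonal factor only rescales coordinates, which leaves one scalar inequality per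
  column. The conjunct \<open>0 \<le> lam\<close> reflects the 0 inserted into the maximum in
  \<open>linf_norm\<close>.\<close>

lemma dantzig_constraint_iff:
  assumes X: "X \<in> carrier_mat n p" and r: "r \<in> carrier_vec n" and n: "n \<ge> 1"
    and N: "\<And>j. j < p \<Longrightarrow> N j > 0"
  shows "linf_norm ((1 / real n) \<cdot>\<^sub>v (mat_diag p (\<lambda>j. inverse (N j)) *\<^sub>v (X\<^sup>T *\<^sub>v r))) \<le> lam \<longleftrightarrow>
    0 \<le> lam \<and> (\<forall>j<p. \<bar>col X j \<bullet> r\<bar> \<le> lam * (real n * N j))"
proof -
  have "\<bar>((1 / real n) \<cdot>\<^sub>v (mat_diag p (\<lambda>j. inverse (N j)) *\<^sub>v (X\<^sup>T *\<^sub>v r))) $ j\<bar> \<le> lam \<longleftrightarrow>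
     \<bar>col X j \<bullet> r\<bar> \<le> lam * (real n * N j)" if j: "j < p" for j
  proof -
    have "(mat_diag p (\<lambda>j. inverse (N j)) *\<^sub>v (X\<^sup>T *\<^sub>v r)) $ j
       = (\<Sum>k<p. (if j = k then inverse (N k) else 0) * (col X k \<bullet> r))"
      using j X by (simp add: mat_diag_def scalar_prod_def[of _ "X\<^sup>T *\<^sub>v r"] lessThan_atLeast0)
    also have "\<dots> = (\<Sum>k<p. if j = k then inverse (N k) * (col X k \<bullet> r) else 0)"
      by (intro sum.cong) auto
    also have "\<dots> = inverse (N j) * (col X j \<bullet> r)" using j by simp
    finally have "((1 / real n) \<cdot>\<^sub>v (mat_diag p (\<lambda>j. inverse (N j)) *\<^sub>v (X\<^sup>T *\<^sub>v r))) $ j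
       = (col X j \<bullet> r) / (real n * N j)"
      using j X by (simp add: mat_diag_def divide_inverse mult_ac)
    then show ?thesis
      using n N[OF j] by (simp add: abs_mult pos_divide_le_eq)
  qed
  moreover have "dim_vec ((1 / real n) \<cdot>\<^sub>v (mat_diag p (\<lambda>j. inverse (N j)) *\<^sub>v (X\<^sup>T *\<^sub>v r))) = p"
    by (simp add: mat_diag_def)
  ultimately show ?thesis by (simp add: linf_norm_le_iff)
qed

text \<open>The deterministic core. The cone bound controls \<open>A *\<^sub>v h\<close> with
  \<open>B = sqrt L * K / sigma_min A\<close>, and one more division by \<open>sigma_min A\<close>
  returns to \<open>h\<close>. The squared prediction error is an inner product of \<open>h\<close>
  with the small vector \<open>u\<close>, so its root carries only \<open>sqrt gap\<close> and the
  first power of \<open>sigma_min A\<close>.\<close>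

lemma dantzig_error_bound:
  assumes A: "A \<in> carrier_mat L p" and X: "X \<in> carrier_mat n p"
    and dims: "n \<ge> 1" "p \<ge> 1" "p \<le> L" and S: "S \<ge> 1"
    and inj: "\<And>v. v \<in> carrier_vec p \<Longrightarrow> A *\<^sub>v v = 0\<^sub>v L \<Longrightarrow> v = 0\<^sub>v p"
  defines "V \<equiv> X * pinv A"
  defines "gap \<equiv> restr_phi V (2 * S) - restr_theta V S (2 * S)"
  assumes gap: "gap > 0"
    and h: "h \<in> carrier_vec p"
    and T0: "T0 \<subseteq> {..<L}" "card T0 \<le> S"
    and cone: "(\<Sum>j\<in>{..<L} - T0. \<bar>(A *\<^sub>v h) $ j\<bar>) \<le> (\<Sum>j\<in>T0. \<bar>(A *\<^sub>v h) $ j\<bar>)"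
    and corr: "\<And>j. j < p \<Longrightarrow> \<bar>col X j \<bullet> (X *\<^sub>v h)\<bar> \<le> real n * K" and K: "K \<ge> 0"
  shows "l2_norm h \<le> sqrt 2 * (sqrt (real L) * K / (gap * (sigma_min A)\<^sup>2))"
    and "emp_norm (X *\<^sub>v h) \<le> sqrt 2 * (sqrt (real L) * K / (sqrt gap * sigma_min A))"
proof -
  note B = pinv_full_column_rank[OF A inj]
  have p: "p > 0" using dims by simp
  define sA where "sA = sigma_min A"
  have sA: "sA > 0" unfolding sA_def by (rule sigma_min_props(1)[OF A p inj])
  have V: "V \<in> carrier_mat n L" using X B by (simp add: V_def)
  define u where "u = (1 / real n) \<cdot>\<^sub>v (X\<^sup>T *\<^sub>v (X *\<^sub>v h))"
  have u: "u \<in> carrier_vec p" using X h by (simp add: u_def)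
  have Xh: "X *\<^sub>v h \<in> carrier_vec n" using X h by simp
  have "\<bar>u $ j\<bar> \<le> K" if "j < p" for j
    using corr[OF that] dims that X by (simp add: u_def abs_mult pos_divide_le_eq mult.commute)
  \<comment> \<open>The \<open>p\<close> entries give the factor \<open>sqrt p\<close>, which
    \<open>p \<le> L\<close> enlarges to \<open>sqrt L\<close>.\<close>
  then have u_le: "l2_norm u \<le> sqrt (real L) * K"
    using l2_norm_le_of_entries[OF u, of K] K mult_right_mono[of "sqrt (real p)" "sqrt (real L)" K] dims
    by force
  have inner_u: "(X *\<^sub>v g) \<bullet> (X *\<^sub>v h) / real n = g \<bullet> u" if g: "g \<in> carrier_vec p" for g
  proof -
    have "(X *\<^sub>v g) \<bullet> (X *\<^sub>v h) = g \<bullet> (X\<^sup>T *\<^sub>v (X *\<^sub>v h))"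
      using scalar_prod_gram[OF X g h] X h by (simp add: assoc_mult_mat_vec[of _ p n])
    then show ?thesis using g X by (simp add: u_def)
  qed
  define d where "d j = (A *\<^sub>v h) $ j" for j
  define W where "W T = V *\<^sub>v vec L (\<lambda>j. if j \<in> T then d j else 0)" for T
  have W: "W T \<in> carrier_vec n" for T using V by (simp add: W_def)
  define q where "q T = sqrt (\<Sum>j\<in>T. (d j)\<^sup>2)" for T
  have Ah: "A *\<^sub>v h \<in> carrier_vec L" using A h by simp
  have vec_U: "vec L (\<lambda>j. if j \<in> {..<L} then d j else 0) = A *\<^sub>v h"
    using A by (intro eq_vecI) (auto simp: d_def)
  have qU: "q {..<L} = l2_norm (A *\<^sub>v h)"
    by (simp only: q_def d_def l2_norm_eq_L2_set[OF Ah] L2_set_def)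
  have "V *\<^sub>v (A *\<^sub>v h) = X *\<^sub>v (pinv A *\<^sub>v (A *\<^sub>v h))"
    unfolding V_def by (rule assoc_mult_mat_vec[OF X B(1) Ah])
  also have "pinv A *\<^sub>v (A *\<^sub>v h) = h"
    using assoc_mult_mat_vec[OF B(1) A h] B(2) h by simp
  finally have WU: "W {..<L} = X *\<^sub>v h" unfolding W_def vec_U .
  have "q {..<L} \<le> sqrt 2 * (sqrt (real L) * K / sA / (restr_phi V (2 * S) - restr_theta V S (2 * S)))"
    unfolding q_def
  proof (rule cone_restricted_bound[where F = "\<lambda>T R. W T \<bullet> W R / real n", OF _ T0 S])
    show "0 \<le> restr_theta V S (2 * S)" by (rule restr_theta_props(1)[OF V])
    show "restr_phi V (2 * S) - restr_theta V S (2 * S) > 0" using gap by (simp add: gap_def)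
    show "0 \<le> sqrt (real L) * K / sA" using K sA by simp
    show "(\<Sum>j\<in>{..<L} - T0. \<bar>d j\<bar>) \<le> (\<Sum>j\<in>T0. \<bar>d j\<bar>)" using cone by (simp add: d_def)
  next
    fix T R R' :: "nat set" assume "R \<inter> R' = {}" "R \<union> R' \<subseteq> {..<L}"
    then have "vec L (\<lambda>j. if j \<in> R \<union> R' then d j else 0)
      = vec L (\<lambda>j. if j \<in> R then d j else 0) + vec L (\<lambda>j. if j \<in> R' then d j else 0)"
      by (intro eq_vecI) auto
    then have "W (R \<union> R') = W R + W R'"
      unfolding W_def using mult_add_distrib_mat_vec[OF V] by simp
    then show "W T \<bullet> W (R \<union> R') / real n = W T \<bullet> W R / real n + W T \<bullet> W R' / real n"
      using scalar_prod_add_distrib[OF W W W] by (simp add: add_divide_distrib)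
  next
    fix T R assume "T \<subseteq> {..<L}" "R \<subseteq> {..<L}" "T \<inter> R = {}" "card T \<le> 2 * S" "card R \<le> S"
    then show "\<bar>W T \<bullet> W R / real n\<bar> \<le> restr_theta V S (2 * S) * sqrt (\<Sum>j\<in>T. (d j)\<^sup>2) * sqrt (\<Sum>j\<in>R. (d j)\<^sup>2)"
      using restr_theta_props(2)[OF V, of R T S "2 * S" d d] comm_scalar_prod[OF W[of T] W[of R]]
      by (simp add: W_def Int_commute mult_ac)
  next
    fix T assume "T \<subseteq> {..<L}" "card T \<le> 2 * S"
    then show "restr_phi V (2 * S) * (sqrt (\<Sum>j\<in>T. (d j)\<^sup>2))\<^sup>2 \<le> W T \<bullet> W T / real n"
      using restr_phi_le[OF V, of "2 * S" T d] dims S by (simp add: W_def l2_norm_square sum_nonneg)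
  next
    fix T assume T: "T \<subseteq> {..<L}"
    let ?c = "vec L (\<lambda>j. if j \<in> T then d j else 0)"
    have g: "pinv A *\<^sub>v ?c \<in> carrier_vec p" using B by simp
    have "l2_norm ?c = sqrt (\<Sum>j\<in>T. (d j)\<^sup>2)"
      using T unfolding l2_norm_def
      by (auto intro!: arg_cong[where f = sqrt] sum.mono_neutral_cong_right)
    then have "sA * l2_norm (pinv A *\<^sub>v ?c) \<le> sqrt (\<Sum>j\<in>T. (d j)\<^sup>2)"
      using l2_norm_pinv_le[OF A p inj, of ?c] by (simp add: sA_def)
    then have c: "l2_norm (pinv A *\<^sub>v ?c) \<le> sqrt (\<Sum>j\<in>T. (d j)\<^sup>2) / sA"
      using sA by (simp add: pos_le_divide_eq mult.commute)
    \<comment> \<open>The pseudoinverse moves the restricted vector into coefficient space, where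
      the bound on \<open>u\<close> applies; the price is the factor \<open>1 / sA\<close>.\<close>
    have "W T = X *\<^sub>v (pinv A *\<^sub>v ?c)"
      unfolding W_def V_def by (rule assoc_mult_mat_vec[OF X B(1)]) simp_all
    then have "W T \<bullet> W {..<L} / real n = (pinv A *\<^sub>v ?c) \<bullet> u"
      using inner_u[OF g] by (simp add: WU)
    also have "\<dots> \<le> l2_norm (pinv A *\<^sub>v ?c) * l2_norm u"
      using abs_scalar_prod_le[OF g u] by linarith
    also have "\<dots> \<le> (sqrt (\<Sum>j\<in>T. (d j)\<^sup>2) / sA) * (sqrt (real L) * K)"
      using c u_le sA by (intro mult_mono) (auto simp: sum_nonneg)
    finally show "W T \<bullet> W {..<L} / real n \<le> sqrt (real L) * K / sA * sqrt (\<Sum>j\<in>T. (d j)\<^sup>2)"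
      by (simp add: mult_ac)
  qed simp
  then have "sA * l2_norm h \<le> sqrt 2 * (sqrt (real L) * K / sA / gap)"
    using sigma_min_props(2)[OF A p inj h] by (simp add: qU gap_def sA_def)
  then have "l2_norm h \<le> sqrt 2 * (sqrt (real L) * K / sA / gap) / sA"
    by (simp only: pos_le_divide_eq[OF sA] mult.commute[of "l2_norm h"])
  also have "\<dots> = sqrt 2 * (sqrt (real L) * K / (gap * sA\<^sup>2))"
    by (simp add: power2_eq_square mult_ac)
  finally have l2h: "l2_norm h \<le> sqrt 2 * (sqrt (real L) * K / (gap * sA\<^sup>2))" .
  then show "l2_norm h \<le> sqrt 2 * (sqrt (real L) * K / (gap * (sigma_min A)\<^sup>2))" by (simp add: sA_def)
  define R where "R = sqrt (real L) * K / (sqrt gap * sA)"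
  have R: "R \<ge> 0" using K gap sA by (simp add: R_def)
  have "(emp_norm (X *\<^sub>v h))\<^sup>2 = h \<bullet> u"
    using inner_u[OF h] by (simp add: emp_norm_eq_l2_norm[OF Xh] power_divide l2_norm_square)
  also have "\<dots> \<le> l2_norm h * l2_norm u"
    using abs_scalar_prod_le[OF h u] by linarith
  also have "\<dots> \<le> (sqrt 2 * (sqrt (real L) * K / (gap * sA\<^sup>2))) * (sqrt (real L) * K)"
    using l2h u_le K gap by (intro mult_mono) auto
  also have "\<dots> = sqrt 2 * R\<^sup>2"
    using gap by (simp add: R_def power_divide power_mult_distrib power2_eq_square mult_ac)
  \<comment> \<open>Enlarging \<open>sqrt 2\<close> to 2 makes the right side the square of
    \<open>sqrt 2 * R\<close>, so both bounds share the factor \<open>sqrt 2\<close>.\<close>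
  also have "\<dots> \<le> 2 * R\<^sup>2" using sqrt2_less_2 by (intro mult_right_mono) auto
  also have "\<dots> = (sqrt 2 * R)\<^sup>2" by (simp add: power_mult_distrib)
  finally have "emp_norm (X *\<^sub>v h) \<le> sqrt 2 * R" by (rule power2_le_imp_le) (use R in simp)
  then show "emp_norm (X *\<^sub>v h) \<le> sqrt 2 * (sqrt (real L) * K / (sqrt gap * sigma_min A))"
    by (simp add: R_def sA_def)
qed

text \<open>\<open>\<eta>_hat\<close> is any pointwise minimiser, with no measurability assumed, so
  the set where the bounds hold need not be an event; the conclusion therefore provides an event
  contained in it. All indices start at 0, which lets \<open>div\<close> and \<open>mod\<close>
  recover the two grid indices.\<close>

theorem theorem1:
  fixes P :: "'a measure"
    and n p m1 m2 d1 d2 L S r1 r2 :: nat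
    and x b :: "nat \<Rightarrow> real \<times> real \<Rightarrow> real"
    and \<beta> \<beta>_star :: "real \<times> real \<Rightarrow> real"
    and \<epsilon> :: "nat \<Rightarrow> 'a \<Rightarrow> real"
    and t s :: "nat \<Rightarrow> real"
    and \<sigma> M C lam \<delta>1 \<delta>2 w E_b C_b N_max gap :: real
    and \<eta>_star \<mu> :: "real Matrix.vec"
    and y \<eta>_hat \<mu>_hat :: "'a \<Rightarrow> real Matrix.vec"
    and \<beta>_hat :: "'a \<Rightarrow> real \<times> real \<Rightarrow> real"
    and X N_inv \<Phi> A_t A_s A V :: "real mat"
    and N :: "nat \<Rightarrow> real"
  assumes "prob_space P"
    and "n \<ge> 1" and "p \<ge> 1"
    and "\<And>i. i < n \<Longrightarrow> x i \<in> L2"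
    and "\<beta> \<in> L2"
    and "\<exists>Z \<in> sets lebesgue. Z \<subseteq> unit_square \<and> emeasure lebesgue Z > 0 \<and> (\<forall>z\<in>Z. \<beta> z = 0)"
    and "\<And>k l. k \<le> r1 \<Longrightarrow> l \<le> r2 \<Longrightarrow> \<exists>g \<in> L2. weak_partial k l \<beta> g"
    and "\<And>\<omega>. y \<omega> = vec n (\<lambda>i. inner_L2 (x i) \<beta> + \<epsilon> i \<omega>)"
    and "\<And>j. j < p \<Longrightarrow> b j \<in> L2"
    and "lin_indep_L2 p b"
    and "is_arg_min (\<lambda>\<eta>. norm_L2 (\<lambda>z. \<beta> z - lincomb_fun b \<eta> z)) (\<lambda>\<eta>. \<eta> \<in> carrier_vec p) \<eta>_star"
    and "\<beta>_star = lincomb_fun b \<eta>_star"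
    and "E_b = norm_L2 (\<lambda>z. \<beta> z - \<beta>_star z)"
    and "X = mat n p (\<lambda>(i, j). inner_L2 (x i) (b j))"
    and "\<And>j. N j = emp_norm (col X j)"
    and "\<And>j. j < p \<Longrightarrow> N j > 0"
    and "N_inv = mat_diag p (\<lambda>j. inverse (N j))"
    and "\<delta>1 > 0" and "\<delta>2 > 0" and "w > 0" and "d1 < m1" and "d2 < m2"
    and "\<And>k l. k < m1 \<Longrightarrow> l < m2 \<Longrightarrow> (t k, s l) \<in> unit_square"
    and "\<And>k. Suc k < m1 \<Longrightarrow> t (Suc k) - t k = \<delta>1"
    and "\<And>l. Suc l < m2 \<Longrightarrow> s (Suc l) - s l = \<delta>2"
    and "\<Phi> = mat p (m1 * m2) (\<lambda>(j, q). b j (t (q div m2), s (q mod m2)))"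
    and "A_t = (1 / \<delta>1 ^ d1) \<cdot>\<^sub>m kron (diff_mat m1 d1) (1\<^sub>m m2)"
    and "A_s = (1 / \<delta>2 ^ d2) \<cdot>\<^sub>m kron (1\<^sub>m m1) (diff_mat m2 d2)"
    and "A = ((w \<cdot>\<^sub>m 1\<^sub>m (m1 * m2)) @\<^sub>r (A_t @\<^sub>r A_s)) * \<Phi>\<^sup>T"
    and "L = m1 * m2 + (m1 - d1) * m2 + m1 * (m2 - d2)"
    and "L \<ge> p" and "vec_space.rank L A = p"
    and "V = X * pinv A"
    and "\<sigma> > 0"
    and "prob_space.indep_vars P (\<lambda>_. borel) \<epsilon> {..<n}"
    and "\<And>i. i < n \<Longrightarrow> distributed P lborel (\<epsilon> i) (normal_density 0 \<sigma>)"
    and "\<And>i. i < n \<Longrightarrow> norm_L2 (x i) \<le> M"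
    and "card {i. i < L \<and> (A *\<^sub>v \<eta>_star) $ i \<noteq> 0} \<le> S"
    and "S \<ge> 1" and "3 * S \<le> L"
    and "gap = restr_phi V (2 * S) - restr_theta V S (2 * S)"
    and "gap > 0"
    and "C > sqrt 2"
    and "lam = C * \<sigma> * sqrt (ln (real p) / real n) + M * E_b"
    and "\<And>\<omega>. \<omega> \<in> space P \<Longrightarrow>
           is_arg_min (\<lambda>\<eta>. l1_norm (A *\<^sub>v \<eta>))
             (\<lambda>\<eta>. \<eta> \<in> carrier_vec p \<and>
               linf_norm ((1 / real n) \<cdot>\<^sub>v (N_inv *\<^sub>v (X\<^sup>T *\<^sub>v (y \<omega> - X *\<^sub>v \<eta>)))) \<le> lam)
             (\<eta>_hat \<omega>)"
    and "\<And>\<omega>. \<beta>_hat \<omega> = lincomb_fun b (\<eta>_hat \<omega>)"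
    and "\<mu> = vec n (\<lambda>i. inner_L2 (x i) \<beta>)"
    and "\<And>\<omega>. \<mu>_hat \<omega> = vec n (\<lambda>i. inner_L2 (x i) (\<beta>_hat \<omega>))"
    and "C_b = sqrt (\<Sum>j<p. \<integral>z. (b j z)\<^sup>2 \<partial>(lebesgue_on unit_square))"
    and "N_max = Max (N ` {..<p})"
  shows "\<exists>E \<in> sets P. measure P E \<ge> 1 - real p powr (1 - C\<^sup>2 / 2) \<and>
    (\<forall>\<omega>\<in>E.
       norm_L2 (\<lambda>z. \<beta>_hat \<omega> z - \<beta> z)
         \<le> 4 * C_b * sqrt (real L) * N_max / (gap * (sigma_min A)\<^sup>2) * lam * sqrt (real S) + E_b \<and>
       emp_norm (\<mu>_hat \<omega> - \<mu>)
         \<le> 4 * sqrt (real L) * N_max / (sqrt gap * sigma_min A) * lam * sqrt (real S) + M * E_b)"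
proof -
  interpret prob_space P by (rule assms(1))
  note n = assms(2) and p = assms(3) and x = assms(4) and \<beta> = assms(5) and b = assms(9)
  note N = assms(15) and Npos = assms(16) and S = assms(39) and gap = assms(42) and lam = assms(44)
  have X: "X \<in> carrier_mat n p" using assms(14) by simp
  have X_entry: "X $$ (i, j) = inner_L2 (x i) (b j)" if "i < n" "j < p" for i j
    using that assms(14) by simp
  have A: "A \<in> carrier_mat L p"
  proof -
    have At: "A_t \<in> carrier_mat ((m1 - d1) * m2) (m1 * m2)"
      and As: "A_s \<in> carrier_mat (m1 * (m2 - d2)) (m1 * m2)"
      using assms(27,28) by (auto simp: kron_def diff_mat_def)
    have "(w \<cdot>\<^sub>m 1\<^sub>m (m1 * m2)) @\<^sub>r (A_t @\<^sub>r A_s) \<in> carrier_mat L (m1 * m2)"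
      unfolding assms(30) add.assoc by (intro carrier_append_rows At As) simp
    then show ?thesis using assms(26,29) by auto
  qed
  have inj: "v = 0\<^sub>v p" if "v \<in> carrier_vec p" "A *\<^sub>v v = 0\<^sub>v L" for v
    using rank_full_imp_injective[OF A assms(32) that] .
  have gap_eq: "restr_phi (X * pinv A) (2 * S) - restr_theta (X * pinv A) S (2 * S) > 0"
    using gap assms(33,41) by simp
  have \<eta>s: "\<eta>_star \<in> carrier_vec p" using assms(11) by (simp add: is_arg_min_def)
  have \<beta>s: "\<beta>_star \<in> L2" using assms(12) lincomb_fun_L2[of p b, OF b \<eta>s] by simp
  have E_b0: "E_b \<ge> 0" using assms(13) by simp
  have M0: "M \<ge> 0" using assms(37)[of 0] n norm_L2_nonneg[of "x 0"] by linarith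
  have C0: "C \<ge> 0" using assms(43) real_sqrt_ge_zero[of 2] by linarith
  have lam0: "lam \<ge> 0"
    unfolding lam using C0 E_b0 M0 assms(34) p by simp
  have N_le: "N j \<le> N_max" if "j < p" for j using assms(50) that by simp
  have Nmax0: "N_max \<ge> 0" using N_le[of 0] Npos[of 0] p by simp
  \<comment> \<open>The approximation error as seen by the \<open>i\<close>-th observation: the
    residual at \<open>\<eta>_star\<close> is noise plus \<open>e\<close>.\<close>
  define e where "e i = inner_L2 (x i) (\<lambda>z. \<beta> z - \<beta>_star z)" for i
  have e_le: "\<bar>e i\<bar> \<le> M * E_b" if "i < n" for i
  proof -
    have "\<bar>e i\<bar> \<le> norm_L2 (x i) * E_b"
      unfolding e_def assms(13) by (intro abs_inner_L2_le x that L2_diff \<beta> \<beta>s)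
    then show ?thesis using mult_right_mono[OF assms(37)[OF that] E_b0] by linarith
  qed
  have X_mult: "(X *\<^sub>v \<eta>) $ i = inner_L2 (x i) (lincomb_fun b \<eta>)" if "i < n" "\<eta> \<in> carrier_vec p" for i \<eta>
    using inner_L2_lincomb_fun[of "x i" p b \<eta>, OF x[OF that(1)] b that(2)] that X X_entry
    by (simp add: scalar_prod_def lessThan_atLeast0)
  have e_eq: "e i = inner_L2 (x i) \<beta> - (X *\<^sub>v \<eta>_star) $ i" if "i < n" for i
    using that x \<beta> \<beta>s X_mult[OF that \<eta>s] assms(12) by (simp add: e_def inner_L2_diff_right)
  \<comment> \<open>This turns the normalisation \<open>N j\<close> into a standard deviation: the
    score of column \<open>j\<close> has standard deviation
    \<open>\<sigma> * sqrt n * N j\<close>.\<close>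
  have col_sum: "(\<Sum>i<n. (X $$ (i, j))\<^sup>2) = real n * (N j)\<^sup>2" if "j < p" for j
    using that n X unfolding N by (simp add: emp_norm_def sum_nonneg)

  \<comment> \<open>The good event keeps all \<open>p\<close> scores within
    \<open>C * sqrt (ln p)\<close> standard deviations; everything after it is
    deterministic.\<close>
  define E where "E = {\<omega> \<in> space P. \<forall>j\<in>{..<p}. \<bar>\<Sum>i<n. X $$ (i, j) * \<epsilon> i \<omega>\<bar>
      \<le> C * sqrt (ln (card {..<p})) * (\<sigma> * sqrt (\<Sum>i<n. (X $$ (i, j))\<^sup>2))}"
  have "E \<in> events" "prob E \<ge> 1 - real (card {..<p}) powr (1 - C\<^sup>2 / 2)"
  proof -
    have pos: "(\<Sum>i<n. (X $$ (i, j))\<^sup>2) > 0" if "j \<in> {..<p}" for j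
      using col_sum[of j] Npos[of j] that n by simp
    have ne: "{..<p} \<noteq> {}" using p lessThan_iff[of 0 p] by force
    have normal: "distributed P lborel (\<epsilon> i) (normal_density 0 \<sigma>)" if "i \<in> {..<n}" for i
      using assms(36) that by simp
    note noise = normal_noise_uniform_bound[of "{..<n}" \<epsilon> \<sigma> "{..<p}" "\<lambda>j i. X $$ (i, j)" C,
        OF finite_lessThan assms(35) normal assms(34) finite_lessThan ne pos C0]
    show "E \<in> events" unfolding E_def by (rule noise(1))
    show "prob E \<ge> 1 - real (card {..<p}) powr (1 - C\<^sup>2 / 2)" unfolding E_def by (rule noise(2))
  qed
  moreover have "norm_L2 (\<lambda>z. \<beta>_hat \<omega> z - \<beta> z)
         \<le> 4 * C_b * sqrt (real L) * N_max / (gap * (sigma_min A)\<^sup>2) * lam * sqrt (real S) + E_b \<and>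
       emp_norm (\<mu>_hat \<omega> - \<mu>)
         \<le> 4 * sqrt (real L) * N_max / (sqrt gap * sigma_min A) * lam * sqrt (real S) + M * E_b"
    if \<omega>: "\<omega> \<in> E" for \<omega>
  proof -
    have sp: "\<omega> \<in> space P" using \<omega> by (simp add: E_def)
    have y: "y \<omega> \<in> carrier_vec n" using assms(8) by simp
    define r where "r \<eta> = y \<omega> - X *\<^sub>v \<eta>" for \<eta>
    have r: "r \<eta> \<in> carrier_vec n" if "\<eta> \<in> carrier_vec p" for \<eta> using y X that by (simp add: r_def)
    define feas where "feas \<eta> \<longleftrightarrow> \<eta> \<in> carrier_vec p \<and> (\<forall>j<p. \<bar>col X j \<bullet> r \<eta>\<bar> \<le> lam * (real n * N j))" for \<eta>
    \<comment> \<open>An equivalence is required, since it rewrites the predicate inside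
      \<open>is_arg_min\<close>: feasibility of \<open>\<eta>_hat\<close> is read off, and
      feasibility of \<open>\<eta>_star\<close> is fed in.\<close>
    have feas_iff: "\<eta> \<in> carrier_vec p \<and>
       linf_norm ((1 / real n) \<cdot>\<^sub>v (N_inv *\<^sub>v (X\<^sup>T *\<^sub>v (y \<omega> - X *\<^sub>v \<eta>)))) \<le> lam \<longleftrightarrow> feas \<eta>" for \<eta>
      using dantzig_constraint_iff[OF X _ n, of "r \<eta>" N lam] r[of \<eta>] Npos lam0
      unfolding feas_def assms(17) r_def by blast
    have arg: "is_arg_min (\<lambda>\<eta>. l1_norm (A *\<^sub>v \<eta>)) feas (\<eta>_hat \<omega>)"
      using assms(45)[OF sp] unfolding feas_iff .
    have feas_hat: "feas (\<eta>_hat \<omega>)" using arg by (simp add: is_arg_min_def)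
    have \<eta>h: "\<eta>_hat \<omega> \<in> carrier_vec p" using feas_hat by (simp add: feas_def)
    \<comment> \<open>The two summands of \<open>lam\<close> match the two parts of the residual:
      the event bounds the noise by the first, Cauchy--Schwarz bounds the contribution of
      \<open>e\<close> by \<open>M * E_b\<close>.\<close>
    have feas_star: "feas \<eta>_star"
      unfolding feas_def
    proof (intro conjI allI impI \<eta>s)
      fix j assume j: "j < p"
      have sq: "sqrt (\<Sum>i<n. (X $$ (i, j))\<^sup>2) = sqrt (real n) * N j"
        using Npos[OF j] by (simp add: col_sum[OF j] real_sqrt_mult)
      have "r \<eta>_star $ i = \<epsilon> i \<omega> + e i" if "i < n" for i
        using that X assms(8) e_eq[OF that] by (simp add: r_def del: index_mult_mat_vec)
      then have "col X j \<bullet> r \<eta>_star = (\<Sum>i<n. X $$ (i, j) * \<epsilon> i \<omega> + X $$ (i, j) * e i)"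
        using X j r[OF \<eta>s] unfolding scalar_prod_def lessThan_atLeast0
        by (intro sum.cong) (auto simp: distrib_left)
      then have "\<bar>col X j \<bullet> r \<eta>_star\<bar> \<le> \<bar>\<Sum>i<n. X $$ (i, j) * \<epsilon> i \<omega>\<bar> + \<bar>\<Sum>i<n. X $$ (i, j) * e i\<bar>"
        by (simp add: sum.distrib)
      also have "\<bar>\<Sum>i<n. X $$ (i, j) * \<epsilon> i \<omega>\<bar> \<le> C * sqrt (ln (real p)) * (\<sigma> * (sqrt (real n) * N j))"
        using \<omega> j by (auto simp: E_def sq[symmetric])
      also have "\<dots> = C * \<sigma> * sqrt (ln (real p) / real n) * (real n * N j)"
        using n by (simp add: real_sqrt_divide field_simps)
      also have "\<bar>\<Sum>i<n. X $$ (i, j) * e i\<bar> \<le> (\<Sum>i<n. \<bar>X $$ (i, j)\<bar> * \<bar>e i\<bar>)"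
        by (simp add: abs_mult[symmetric])
      also have "\<dots> \<le> L2_set (\<lambda>i. X $$ (i, j)) {..<n} * L2_set e {..<n}"
        by (rule L2_set_mult_ineq)
      also have "\<dots> \<le> (sqrt (real n) * N j) * (sqrt (real n) * (M * E_b))"
      proof (rule mult_mono)
        have "l2_norm (vec n e) \<le> sqrt (real n) * (M * E_b)"
          using e_le M0 E_b0 by (intro l2_norm_le_of_entries) auto
        then show "L2_set e {..<n} \<le> sqrt (real n) * (M * E_b)"
          by (simp add: l2_norm_def L2_set_def)
      qed (use Npos[OF j] sq in \<open>auto simp: L2_set_def sum_nonneg\<close>)
      also have "\<dots> = M * E_b * (real n * N j)" by simp
      finally show "\<bar>col X j \<bullet> r \<eta>_star\<bar> \<le> lam * (real n * N j)"
        by (simp add: lam distrib_right)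
    qed
    define h where "h = \<eta>_hat \<omega> - \<eta>_star"
    have h: "h \<in> carrier_vec p" using \<eta>h \<eta>s by (simp add: h_def)
    have Ah: "(A *\<^sub>v h) $ i = (A *\<^sub>v \<eta>_hat \<omega>) $ i - (A *\<^sub>v \<eta>_star) $ i" if "i < L" for i
      using that A \<eta>h \<eta>s by (simp add: h_def mult_minus_distrib_mat_vec[of _ L p])
    define T0 where "T0 = {i. i < L \<and> (A *\<^sub>v \<eta>_star) $ i \<noteq> 0}"
    have T0: "T0 \<subseteq> {..<L}" "card T0 \<le> S" using assms(38) by (auto simp: T0_def)
    have "l1_norm (A *\<^sub>v \<eta>_hat \<omega>) \<le> l1_norm (A *\<^sub>v \<eta>_star)"
      using arg feas_star by (auto simp: is_arg_min_def not_less)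
    then have "(\<Sum>i<L. \<bar>(A *\<^sub>v \<eta>_hat \<omega>) $ i\<bar>) \<le> (\<Sum>i<L. \<bar>(A *\<^sub>v \<eta>_star) $ i\<bar>)"
      using A by (simp add: l1_norm_def)
    then have "(\<Sum>i\<in>{..<L} - T0. \<bar>(A *\<^sub>v \<eta>_hat \<omega>) $ i - (A *\<^sub>v \<eta>_star) $ i\<bar>)
        \<le> (\<Sum>i\<in>T0. \<bar>(A *\<^sub>v \<eta>_hat \<omega>) $ i - (A *\<^sub>v \<eta>_star) $ i\<bar>)"
      using T0 by (intro sum_abs_cone) (auto simp: T0_def)
    then have cone: "(\<Sum>i\<in>{..<L} - T0. \<bar>(A *\<^sub>v h) $ i\<bar>) \<le> (\<Sum>i\<in>T0. \<bar>(A *\<^sub>v h) $ i\<bar>)"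
      using T0 by (simp add: Ah subset_iff)
    \<comment> \<open>\<open>X *\<^sub>v h\<close> is the difference of two feasible residuals,
      whence the factor 2 in front of \<open>lam\<close>.\<close>
    have corr: "\<bar>col X j \<bullet> (X *\<^sub>v h)\<bar> \<le> real n * (2 * lam * N_max)" if j: "j < p" for j
    proof -
      have c: "col X j \<in> carrier_vec n" using X j by (metis col_carrier_vec carrier_matD(2))
      have "X *\<^sub>v h = r \<eta>_star - r (\<eta>_hat \<omega>)"
        using X \<eta>h \<eta>s y by (intro eq_vecI) (auto simp: h_def r_def mult_minus_distrib_mat_vec[of _ n p] simp del: index_mult_mat_vec)
      then have "col X j \<bullet> (X *\<^sub>v h) = col X j \<bullet> r \<eta>_star - col X j \<bullet> r (\<eta>_hat \<omega>)"
        using scalar_prod_minus_distrib[OF c r[OF \<eta>s] r[OF \<eta>h]] by simp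
      also have "\<bar>\<dots>\<bar> \<le> 2 * lam * (real n * N j)"
        using feas_star feas_hat j unfolding feas_def by fastforce
      also have "\<dots> \<le> 2 * lam * (real n * N_max)"
        using lam0 N_le[OF j] by (intro mult_left_mono) auto
      finally show ?thesis by (simp add: mult_ac)
    qed
    have K0: "0 \<le> 2 * lam * N_max" using lam0 Nmax0 by simp
    note bound = dantzig_error_bound[OF A X n p assms(31) S inj gap_eq h T0 cone corr K0,
        folded assms(33), folded assms(41)]
    have bound_h: "l2_norm h \<le> sqrt 2 * (sqrt (real L) * (2 * lam * N_max) / (gap * (sigma_min A)\<^sup>2))"
      by (rule bound(1))
    have bound_Xh: "emp_norm (X *\<^sub>v h)
        \<le> sqrt 2 * (sqrt (real L) * (2 * lam * N_max) / (sqrt gap * sigma_min A))"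
      by (rule bound(2))
    have "p > 0" using p by simp
    then have sA: "sigma_min A > 0" by (rule sigma_min_props(1)[OF A _ inj])
    \<comment> \<open>The deterministic bounds carry the constant \<open>2 * sqrt 2\<close>; with
      \<open>S \<ge> 1\<close> it is enlarged to the stated \<open>4 * sqrt S\<close>.\<close>
    have sqrt_S: "sqrt 2 * 2 \<le> 4 * sqrt (real S)"
      using sqrt2_less_2 S real_sqrt_ge_one[of "real S"] by linarith
    have widen: "sqrt 2 * (sqrt (real L) * (2 * lam * N_max) / D)
        \<le> 4 * sqrt (real L) * N_max / D * lam * sqrt (real S)" if "D > 0" for D
    proof -
      have "(sqrt 2 * 2) * (sqrt (real L) * N_max * lam / D) \<le> (4 * sqrt (real S)) * (sqrt (real L) * N_max * lam / D)"
        using that lam0 Nmax0 by (intro mult_right_mono[OF sqrt_S]) simp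
      then show ?thesis by (simp add: mult_ac)
    qed
    have h_le: "l2_norm h \<le> 4 * sqrt (real L) * N_max / (gap * (sigma_min A)\<^sup>2) * lam * sqrt (real S)"
      using bound_h widen[of "gap * (sigma_min A)\<^sup>2"] gap sA by simp
    have Xh_le: "emp_norm (X *\<^sub>v h) \<le> 4 * sqrt (real L) * N_max / (sqrt gap * sigma_min A) * lam * sqrt (real S)"
      using bound_Xh widen[of "sqrt gap * sigma_min A"] gap sA by simp
    have lin: "lincomb_fun b h z = lincomb_fun b (\<eta>_hat \<omega>) z - lincomb_fun b \<eta>_star z" for z
      using \<eta>h \<eta>s by (simp add: lincomb_fun_def h_def sum_subtractf[symmetric] left_diff_distrib)
    have bh: "lincomb_fun b h \<in> L2" by (rule lincomb_fun_L2[of p b, OF b h])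
    \<comment> \<open>Estimation error within the span of the basis plus approximation error of
      \<open>\<beta>_star\<close>.\<close>
    have "(\<lambda>z. \<beta>_hat \<omega> z - \<beta> z) = (\<lambda>z. lincomb_fun b h z + (\<beta>_star z - \<beta> z))"
      using assms(12,46) by (simp add: lin fun_eq_iff)
    then have "norm_L2 (\<lambda>z. \<beta>_hat \<omega> z - \<beta> z) \<le> norm_L2 (lincomb_fun b h) + E_b"
      using norm_L2_triangle[OF bh L2_diff[OF \<beta>s \<beta>]] assms(13) norm_L2_minus_commute[of \<beta> \<beta>_star] by simp
    also have "norm_L2 (lincomb_fun b h) \<le> C_b * l2_norm h"
      using norm_L2_lincomb_fun_le[of p b h, OF b h] assms(49) by simp
    also have "C_b * l2_norm h \<le> C_b * (4 * sqrt (real L) * N_max / (gap * (sigma_min A)\<^sup>2) * lam * sqrt (real S))"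
      using h_le assms(49) by (intro mult_left_mono) (auto simp: sum_nonneg)
    finally have 1: "norm_L2 (\<lambda>z. \<beta>_hat \<omega> z - \<beta> z)
         \<le> 4 * C_b * sqrt (real L) * N_max / (gap * (sigma_min A)\<^sup>2) * lam * sqrt (real S) + E_b"
      by (simp add: mult_ac)
    have Xh: "X *\<^sub>v h \<in> carrier_vec n" using X h by simp
    \<comment> \<open>The same splitting at the level of the fitted means, where each entry of
      \<open>e\<close> is at most \<open>M * E_b\<close>.\<close>
    have "\<mu>_hat \<omega> - \<mu> = X *\<^sub>v h + vec n (\<lambda>i. - e i)"
    proof (rule eq_vecI)
      fix i assume "i < dim_vec (X *\<^sub>v h + vec n (\<lambda>i. - e i))"
      then have i: "i < n" by simp
      have "(X *\<^sub>v h) $ i = (X *\<^sub>v \<eta>_hat \<omega>) $ i - (X *\<^sub>v \<eta>_star) $ i"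
        using i X \<eta>h \<eta>s by (simp add: h_def mult_minus_distrib_mat_vec[of _ n p])
      then show "(\<mu>_hat \<omega> - \<mu>) $ i = (X *\<^sub>v h + vec n (\<lambda>i. - e i)) $ i"
        using i Xh assms(46,47,48) X_mult[OF i \<eta>h] e_eq[OF i] by simp
    qed (use X assms(47,48) in simp)
    then have "l2_norm (\<mu>_hat \<omega> - \<mu>) \<le> l2_norm (X *\<^sub>v h) + l2_norm (vec n (\<lambda>i. - e i))"
      using l2_norm_triangle[OF Xh, of "vec n (\<lambda>i. - e i)"] by simp
    also have "l2_norm (vec n (\<lambda>i. - e i)) \<le> sqrt (real n) * (M * E_b)"
      using e_le M0 E_b0 by (intro l2_norm_le_of_entries) auto
    finally have "l2_norm (\<mu>_hat \<omega> - \<mu>) / sqrt (real n) \<le> (l2_norm (X *\<^sub>v h) + sqrt (real n) * (M * E_b)) / sqrt (real n)"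
      by (intro divide_right_mono) auto
    also have "\<dots> = emp_norm (X *\<^sub>v h) + M * E_b"
      using n by (simp add: add_divide_distrib emp_norm_eq_l2_norm[OF Xh])
    finally have "emp_norm (\<mu>_hat \<omega> - \<mu>) \<le> emp_norm (X *\<^sub>v h) + M * E_b"
      using assms(47,48) by (subst emp_norm_eq_l2_norm[of _ n]) auto
    with Xh_le 1 show ?thesis by simp
  qed
  ultimately show ?thesis by (intro bexI[of _ E]) auto
qed

end
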